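(* Let $\alpha>0$, $c\ge1$, $R>0$, $\kappa_c=L(\Lambda_c)/\alpha$, $d(\Lambda_c)=\|\lambda^*\|+c$, and run the ACGD-S method with the stepsize rule $\mathrm{SC}(L(\Lambda_c),R)$ (method and rule described in the context). Let $A_R:=\|x^0-x^*\|^2+2d(\Lambda_c)^2/R^2$ and suppose $$0<\epsilon\le\frac{\sqrt{L(\Lambda_c)\alpha}\,A_R}{\sqrt2}.$$ Then the numbers of first-order-oracle evaluations $N_\epsilon$ and of matrix-vector multiplications $C_\epsilon$ required by the method to find an $(\epsilon;\epsilon/c)$-optimal solution are bounded by $$N_\epsilon=O\Big\{\sqrt{\kappa_c}\log\Big(\frac{\sqrt{L(\Lambda_c)\alpha}\,A_R}{\epsilon}\Big)+1\Big\},\qquad C_\epsilon=O\Big\{N_\epsilon+\frac{\bar M}{\sqrt{\alpha\epsilon}}\big(R\|x^0-x^*\|+d(\Lambda_c)\big)\Big\}.$$ Moreover, if $x^0\ne x^*$ and $R=d(\Lambda_c)/\|x^0-x^*\|$, then $$N_\epsilon=O\Big\{\sqrt{\kappa_c}\log\Big(\frac{3\sqrt{L(\Lambda_c)\alpha}\,\|x^0-x^*\|^2}{\epsilon}\Big)+1\Big\},\qquad C_\epsilon=O\Big\{\frac{\bar M\,d(\Lambda_c)}{\sqrt{\alpha\epsilon}}+N_\epsilon\Big\}.$$ All $O$-constants are absolute. Here $\bar M$ is an upper bound for $\max\{1,\|\nabla g(x)\|\}$ over the bounded neighborhood of $x^*$ in which the points $\underline x^t$ remain.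
   Context: Problem: $\min_{x\in X}\{F(x):=f(x)+u(x)\}$ subject to $g(x)\le 0$, where $X\subseteq\mathbb R^n$ is closed and convex, $f:\mathbb R^n\to\mathbb R$ and $g=(g_1,\dots,g_m):\mathbb R^n\to\mathbb R^m$ are convex (componentwise) and differentiable with Lipschitz continuous gradients, and $u$ is a convex, $\alpha$-strongly convex function. Norms are Euclidean (operator norm for matrices), $[\cdot]_+$ is the componentwise positive part, $\nabla g(x)$ is the $m\times n$ Jacobian. There is a KKT pair: $x^*\in X$ optimal, $\lambda^*\in\mathbb R^m_+$ with $-[\nabla f(x^* )+\sum_i\lambda_i^*\nabla g_i(x^* )+u']\in N_X(x^* )$ for some $u'\in\partial u(x^* )$, $g(x^* )\le0$, $\lambda^*_ig_i(x^* )=0$ for all $i$; $F_*=F(x^* )$. A point $x$ is $(\epsilon;\epsilon/c)$-optimal if $F(x)-F_*\le\epsilon$ and $\|[g(x)]_+\|\le\epsilon/c$. For $\lambda\in\mathbb R^m_+$, $L_\lambda$ is a Lipschitz constant on $\mathbb R^n$ of the gradient of $f+\sum_i\lambda_ig_i$; $L(\Lambda)=\sup_{\lambda\in\Lambda}L_\lambda$; $\Lambda_r=\{0\}\cup\{\lambda^*+\lambda:\lambda\in\mathbb R^m_+,\|\lambda\|\le r\}$. Convention: the Lipschitz constant $L_f$ of $\nabla f$ is chosen with $L_f\ge\alpha$, so $\kappa_c\ge1$. Complexity bounds concern the nontrivial regime in which $x^0$ does not already satisfy the termination criterion. ACGD-S method: $x^{-1}=\underline x^0=y^{(1)}_0=x^0\in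 X$, $\pi^0=\nabla f(x^0)$, $\nu^0=\nabla g(x^0)$, $\lambda^{(1)}_{-1}=\lambda^{(1)}_0=0$. For phases $t=1,2,\dots,N$: 1. $\tilde x^t=x^{t-1}+\theta_t(x^{t-1}-x^{t-2})$, $\underline x^t=(\tau_t\underline x^{t-1}+\tilde x^t)/(1+\tau_t)$, $\pi^t=\nabla f(\underline x^t)$, $\nu^t=\nabla g(\underline x^t)$; compute $S_t$ and the inner parameters. 2. For $s=1,\dots,S_t$: $\tilde h^{(t),s}=(\nu^t)^\top\lambda^{(t)}_0+\rho^{(t)}_1(\nu^{t-1})^\top(\lambda^{(t)}_0-\lambda^{(t)}_{-1})$ if $s=1$, and $\tilde h^{(t),s}=(\nu^t)^\top\lambda^{(t)}_{s-1}+\rho^{(t)}_s(\nu^t)^\top(\lambda^{(t)}_{s-1}-\lambda^{(t)}_{s-2})$ otherwise; $y^{(t)}_s=\operatorname{argmin}_{y\in X}\langle\tilde h^{(t),s}+\pi^t,y\rangle+u(y)+\frac{\eta_t}2\|y-x^{t-1}\|^2+\frac{\beta^{(t)}_s}2\|y-y^{(t)}_{s-1}\|^2$; $\lambda^{(t)}_s=\operatorname{argmax}_{\lambda\in\mathbb R^m_+}\langle\lambda,\nu^t(y^{(t)}_s-\underline x^t)+g(\underline x^t)\rangle-\frac{\gamma^{(t)}_s}2\|\lambda-\lambda^{(t)}_{s-1}\|^2$. 3. $\lambda^{(t+1)}_0=\lambda^{(t)}_{S_t}$, $\lambda^{(t+1)}_{-1}=\lambda^{(t)}_{S_t-1}$,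 $y^{(t+1)}_0=y^{(t)}_{S_t}$; $x^t=\sum_s\delta^{(t)}_sy^{(t)}_s/\sum_s\delta^{(t)}_s$. Output $\bar x^N=\sum_{t\le N}\omega_tx^t/\sum_{t\le N}\omega_t$. One oracle evaluation is made per phase, and each inner iteration uses fewer than three matrix-vector multiplications. Rule $\mathrm{SC}(L,R)$: with $\kappa=L/\alpha$, $\tau_t=\min\{\frac{t-1}2,\sqrt{2\kappa}\}$, $\eta_t=L/\tau_{t+1}$, $\theta_t=\tau_t/(\tau_{t-1}+1)$, $\omega_1=1$, $\omega_t=\omega_{t-1}/\theta_t$ ($t\ge2$). $M_t=\|\nu^t\|$ if $\|\nu^t\|>0$, else $1$; $\Delta=R^2/(\alpha L)$. Phase 1: $S_1=\min\{S\in\mathbb N_+:\sum_{s=1}^Ss\ge\omega_1M_1^2\Delta\}$, $\Gamma_1\ge0$ solves $\sum_{s=1}^{S_1}s=\Gamma_1^2\omega_1M_1^2\Delta$, $\delta^{(1)}_s=s/\Gamma_1$, $\beta^{(1)}_s=\frac\alpha4(s-1)$, $\gamma^{(1)}_s=\frac4\alpha M_1^2\Gamma_1/\delta^{(1)}_s$, $W_2=\delta^{(1)}_{S_1}/M_1$. Phase $t\ge2$: $S_t=\min\{S\in\mathbb N_+:\sum_{s=1}^S[W_tM_t+(s-1)]\ge\omega_tM_t^2\Delta\}$, $\Gamma_t\ge0$ solves $\sum_{s=1}^{S_t}[\Gamma_tW_tM_t+(s-1)]=\Gamma_t^2\omega_tM_t^2\Delta$, $\delta^{(t)}_s=W_tM_t+(s-1)/\Gamma_t$,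 $\gamma^{(t)}_s=\frac4\alpha M_t^2\Gamma_t/\delta^{(t)}_s$, $\beta^{(t)}_1=\frac\alpha4W_t\Gamma_tM_t$, $\beta^{(t)}_s=\frac\alpha4[W_t\Gamma_tM_t+(s-2)]$ ($s\ge2$), $W_{t+1}=\delta^{(t)}_{S_t}/M_t$. Finally $\rho^{(t)}_s=\delta^{(t)}_{s-1}/\delta^{(t)}_s$ for $s\ge2$, $\rho^{(t)}_1=w^{(t-1)}_{S_{t-1}}/w^{(t)}_1$ for $t\ge2$ with $w^{(t)}_s=\omega_t\delta^{(t)}_s/\sum_{s'}\delta^{(t)}_{s'}$. *)

theory Defs
  imports "HOL-Analysis.Analysis"
begin

subsection \<open>Gradients, Jacobians, norms, convex analysis\<close>

definition grad :: "('a::real_inner \<Rightarrow> real) \<Rightarrow> 'a \<Rightarrow> 'a" where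
  "grad f x = (THE D. GDERIV f x :> D)"

abbreviation jac :: "(real^'n \<Rightarrow> real^'m) \<Rightarrow> real^'n \<Rightarrow> real^'n^'m" where
  "jac g x \<equiv> jacobian g (at x)"

text \<open>The type-class norm on \<open>real^'n^'m\<close> is the Frobenius norm, so the operator norm is
  spelled out.\<close>

definition opnorm :: "real^'n^'m \<Rightarrow> real" where
  "opnorm A = onorm (\<lambda>v. A *v v)"

definition pos_part :: "real^'m \<Rightarrow> real^'m" where
  "pos_part v = (\<chi> i. max 0 (v $ i))"

definition nonneg_orthant :: "(real^'m) set" where
  "nonneg_orthant = {l. \<forall>i. 0 \<le> l $ i}"

definition strongly_convex_on :: "'a::real_inner set \<Rightarrow> real \<Rightarrow> ('a \<Rightarrow> real) \<Rightarrow> bool" where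
  "strongly_convex_on X a u \<longleftrightarrow> convex X \<and>
     (\<forall>x\<in>X. \<forall>y\<in>X. \<forall>t\<in>{0..1}.
        u ((1 - t) *\<^sub>R x + t *\<^sub>R y)
          \<le> (1 - t) * u x + t * u y - a / 2 * t * (1 - t) * (norm (x - y))\<^sup>2)"

definition normal_cone :: "'a::real_inner set \<Rightarrow> 'a \<Rightarrow> 'a set" where
  "normal_cone X x = {v. \<forall>y\<in>X. v \<bullet> (y - x) \<le> 0}"

text \<open>\<open>u\<close> is regarded as a real-valued function on \<open>X\<close>; its values outside \<open>X\<close> never matter.
  The set below contains the subdifferential of any convex extension of \<open>u\<close>.\<close>

definition subdiff_on :: "'a::real_inner set \<Rightarrow> ('a \<Rightarrow> real) \<Rightarrow> 'a \<Rightarrow> 'a set" where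
  "subdiff_on X u x = {v. \<forall>y\<in>X. u x + v \<bullet> (y - x) \<le> u y}"

subsection \<open>The constrained problem\<close>

definition optimal_solution ::
  "(real^'n) set \<Rightarrow> (real^'n \<Rightarrow> real) \<Rightarrow> (real^'n \<Rightarrow> real^'m) \<Rightarrow> real^'n \<Rightarrow> bool" where
  "optimal_solution X F g xs \<longleftrightarrow>
     xs \<in> X \<and> (\<forall>i. g xs $ i \<le> 0) \<and> (\<forall>x\<in>X. (\<forall>i. g x $ i \<le> 0) \<longrightarrow> F xs \<le> F x)"

definition kkt_pair ::
  "(real^'n) set \<Rightarrow> (real^'n \<Rightarrow> real) \<Rightarrow> (real^'n \<Rightarrow> real^'m) \<Rightarrow> (real^'n \<Rightarrow> real)
     \<Rightarrow> real^'n \<Rightarrow> real^'m \<Rightarrow> bool" where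
  "kkt_pair X f g u xs ls \<longleftrightarrow>
     optimal_solution X (\<lambda>x. f x + u x) g xs \<and> ls \<in> nonneg_orthant \<and>
     (\<exists>u' \<in> subdiff_on X u xs.
        - (grad f xs + (\<Sum>i\<in>UNIV. (ls $ i) *\<^sub>R grad (\<lambda>x. g x $ i) xs) + u') \<in> normal_cone X xs) \<and>
     (\<forall>i. ls $ i * g xs $ i = 0)"

definition approx_optimal ::
  "(real^'n \<Rightarrow> real) \<Rightarrow> real \<Rightarrow> (real^'n \<Rightarrow> real^'m) \<Rightarrow> real \<Rightarrow> real \<Rightarrow> real^'n \<Rightarrow> bool" where
  "approx_optimal F Fmin g e1 e2 x \<longleftrightarrow> F x - Fmin \<le> e1 \<and> norm (pos_part (g x)) \<le> e2"

definition multiplier_set :: "real^'m \<Rightarrow> real \<Rightarrow> (real^'m) set" where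
  "multiplier_set ls r = {0} \<union> {ls + l | l. l \<in> nonneg_orthant \<and> norm l \<le> r}"

subsection \<open>The method\<close>

text \<open>Arguments are ordered as \<open>t\<close>, then \<open>s\<close>. The fields \<open>st_W\<close> and \<open>st_Gamma\<close> are the
  auxiliary scalars of the stepsize rule and \<open>st_S\<close> is the number of inner iterations.\<close>

record steps =
  st_tau :: "nat \<Rightarrow> real"
  st_eta :: "nat \<Rightarrow> real"
  st_theta :: "nat \<Rightarrow> real"
  st_omega :: "nat \<Rightarrow> real"
  st_S :: "nat \<Rightarrow> nat"
  st_Gamma :: "nat \<Rightarrow> real"
  st_W :: "nat \<Rightarrow> real"
  st_delta :: "nat \<Rightarrow> nat \<Rightarrow> real"
  st_beta :: "nat \<Rightarrow> nat \<Rightarrow> real"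
  st_gamma :: "nat \<Rightarrow> nat \<Rightarrow> real"
  st_rho :: "nat \<Rightarrow> nat \<Rightarrow> real"

text \<open>\<open>it_xu\<close> holds the points where the oracle is called (the underlined \<open>x\<close>); \<open>it_lamm t\<close> is
  the multiplier with inner index \<open>-1\<close> in phase \<open>t\<close>, and \<open>it_lam t s\<close> the one with index
  \<open>s \<ge> 0\<close>.\<close>

record ('n, 'm) iterates =
  it_x :: "nat \<Rightarrow> real^'n"
  it_xu :: "nat \<Rightarrow> real^'n"
  it_pi :: "nat \<Rightarrow> real^'n"
  it_nu :: "nat \<Rightarrow> real^'n^'m"
  it_h :: "nat \<Rightarrow> nat \<Rightarrow> real^'n"
  it_y :: "nat \<Rightarrow> nat \<Rightarrow> real^'n"
  it_lam :: "nat \<Rightarrow> nat \<Rightarrow> real^'m"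
  it_lamm :: "nat \<Rightarrow> real^'m"

definition acgd_init ::
  "(real^'n) set \<Rightarrow> (real^'n \<Rightarrow> real) \<Rightarrow> (real^'n \<Rightarrow> real^'m) \<Rightarrow> real^'n
     \<Rightarrow> ('n::finite, 'm::finite) iterates \<Rightarrow> bool" where
  "acgd_init X f g x0 r \<longleftrightarrow>
     x0 \<in> X \<and> it_x r 0 = x0 \<and> it_xu r 0 = x0 \<and> it_y r 1 0 = x0 \<and>
     it_pi r 0 = grad f x0 \<and> it_nu r 0 = jac g x0 \<and>
     it_lamm r 1 = 0 \<and> it_lam r 1 0 = 0"

text \<open>For \<open>t = 1\<close> the truncated index \<open>t - 2 = 0\<close> gives \<open>it_x r 0\<close>, which is the convention
  \<open>x\<^sup>-\<^sup>1 = x\<^sup>0\<close>.\<close>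

definition acgd_outer_step ::
  "(real^'n \<Rightarrow> real) \<Rightarrow> (real^'n \<Rightarrow> real^'m) \<Rightarrow> steps \<Rightarrow> ('n::finite, 'm::finite) iterates
     \<Rightarrow> nat \<Rightarrow> bool" where
  "acgd_outer_step f g p r t \<longleftrightarrow>
     (let xt = it_x r (t - 1) + st_theta p t *\<^sub>R (it_x r (t - 1) - it_x r (t - 2)) in
        it_xu r t = (st_tau p t *\<^sub>R it_xu r (t - 1) + xt) /\<^sub>R (1 + st_tau p t)) \<and>
     it_pi r t = grad f (it_xu r t) \<and>
     it_nu r t = jac g (it_xu r t)"

text \<open>In phase 1 the parameter \<open>st_rho p 1 1\<close> multiplies the zero vector, so it needs no value.\<close>

definition acgd_inner_step ::
  "(real^'n) set \<Rightarrow> (real^'n \<Rightarrow> real^'m) \<Rightarrow> (real^'n \<Rightarrow> real) \<Rightarrow> steps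
     \<Rightarrow> ('n::finite, 'm::finite) iterates \<Rightarrow> nat \<Rightarrow> nat \<Rightarrow> bool" where
  "acgd_inner_step X g u p r t s \<longleftrightarrow>
     it_h r t s =
       (if s = 1
        then transpose (it_nu r t) *v it_lam r t 0
             + st_rho p t 1 *\<^sub>R (transpose (it_nu r (t - 1)) *v (it_lam r t 0 - it_lamm r t))
        else transpose (it_nu r t) *v it_lam r t (s - 1)
             + st_rho p t s *\<^sub>R
                 (transpose (it_nu r t) *v (it_lam r t (s - 1) - it_lam r t (s - 2)))) \<and>
     is_arg_min
       (\<lambda>y. (it_h r t s + it_pi r t) \<bullet> y + u y
             + st_eta p t / 2 * (norm (y - it_x r (t - 1)))\<^sup>2
             + st_beta p t s / 2 * (norm (y - it_y r t (s - 1)))\<^sup>2)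
       (\<lambda>y. y \<in> X) (it_y r t s) \<and>
     is_arg_max
       (\<lambda>l. l \<bullet> (it_nu r t *v (it_y r t s - it_xu r t) + g (it_xu r t))
             - st_gamma p t s / 2 * (norm (l - it_lam r t (s - 1)))\<^sup>2)
       (\<lambda>l. l \<in> nonneg_orthant) (it_lam r t s)"

definition acgd_phase_end ::
  "steps \<Rightarrow> ('n::finite, 'm::finite) iterates \<Rightarrow> nat \<Rightarrow> bool" where
  "acgd_phase_end p r t \<longleftrightarrow>
     it_lam r (t + 1) 0 = it_lam r t (st_S p t) \<and>
     it_lamm r (t + 1) = it_lam r t (st_S p t - 1) \<and>
     it_y r (t + 1) 0 = it_y r t (st_S p t) \<and>
     it_x r t = (\<Sum>s = 1..st_S p t. st_delta p t s *\<^sub>R it_y r t s)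
                  /\<^sub>R (\<Sum>s = 1..st_S p t. st_delta p t s)"

definition acgd_s_run ::
  "(real^'n) set \<Rightarrow> (real^'n \<Rightarrow> real) \<Rightarrow> (real^'n \<Rightarrow> real^'m) \<Rightarrow> (real^'n \<Rightarrow> real) \<Rightarrow> real^'n
     \<Rightarrow> steps \<Rightarrow> ('n::finite, 'm::finite) iterates \<Rightarrow> bool" where
  "acgd_s_run X f g u x0 p r \<longleftrightarrow>
     acgd_init X f g x0 r \<and>
     (\<forall>t\<ge>1. acgd_outer_step f g p r t \<and>
            (\<forall>s\<in>{1..st_S p t}. acgd_inner_step X g u p r t s) \<and>
            acgd_phase_end p r t)"

definition acgd_output :: "steps \<Rightarrow> ('n::finite, 'm::finite) iterates \<Rightarrow> nat \<Rightarrow> real^'n" where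
  "acgd_output p r N =
     (\<Sum>t = 1..N. st_omega p t *\<^sub>R it_x r t) /\<^sub>R (\<Sum>t = 1..N. st_omega p t)"

subsection \<open>The stepsize rule\<close>

definition nu_size :: "('n::finite, 'm::finite) iterates \<Rightarrow> nat \<Rightarrow> real" where
  "nu_size r t = (if opnorm (it_nu r t) > 0 then opnorm (it_nu r t) else 1)"

definition sc_outer :: "real \<Rightarrow> real \<Rightarrow> steps \<Rightarrow> bool" where
  "sc_outer \<alpha> L p \<longleftrightarrow>
     (\<forall>t. st_tau p t = min ((real t - 1) / 2) (sqrt (2 * (L / \<alpha>)))) \<and>
     (\<forall>t\<ge>1. st_eta p t = L / st_tau p (t + 1)) \<and>
     (\<forall>t\<ge>1. st_theta p t = st_tau p t / (st_tau p (t - 1) + 1)) \<and>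
     st_omega p 1 = 1 \<and>
     (\<forall>t\<ge>2. st_omega p t = st_omega p (t - 1) / st_theta p t)"

definition sc_phase_first :: "real \<Rightarrow> real \<Rightarrow> real \<Rightarrow> steps \<Rightarrow> bool" where
  "sc_phase_first \<alpha> \<Delta> M p \<longleftrightarrow>
     st_S p 1 = (LEAST S. 1 \<le> S \<and> (\<Sum>s = 1..S. real s) \<ge> st_omega p 1 * M\<^sup>2 * \<Delta>) \<and>
     st_Gamma p 1 \<ge> 0 \<and>
     (\<Sum>s = 1..st_S p 1. real s) = (st_Gamma p 1)\<^sup>2 * st_omega p 1 * M\<^sup>2 * \<Delta> \<and>
     (\<forall>s\<in>{1..st_S p 1}.
        st_delta p 1 s = real s / st_Gamma p 1 \<and>
        st_beta p 1 s = \<alpha> / 4 * (real s - 1) \<and>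
        st_gamma p 1 s = 4 / \<alpha> * M\<^sup>2 * st_Gamma p 1 / st_delta p 1 s) \<and>
     st_W p 2 = st_delta p 1 (st_S p 1) / M"

text \<open>If \<open>st_S p t = 1\<close>, the quadratic equation for \<open>st_Gamma p t\<close> also has the root 0, for which
  the formula for \<open>st_delta\<close> would divide by zero; the positive root, which is unique, is meant.\<close>

definition sc_phase_later :: "real \<Rightarrow> real \<Rightarrow> real \<Rightarrow> steps \<Rightarrow> nat \<Rightarrow> bool" where
  "sc_phase_later \<alpha> \<Delta> M p t \<longleftrightarrow>
     st_S p t = (LEAST S. 1 \<le> S \<and>
        (\<Sum>s = 1..S. st_W p t * M + (real s - 1)) \<ge> st_omega p t * M\<^sup>2 * \<Delta>) \<and>
     st_Gamma p t > 0 \<and>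
     (\<Sum>s = 1..st_S p t. st_Gamma p t * st_W p t * M + (real s - 1))
        = (st_Gamma p t)\<^sup>2 * st_omega p t * M\<^sup>2 * \<Delta> \<and>
     (\<forall>s\<in>{1..st_S p t}.
        st_delta p t s = st_W p t * M + (real s - 1) / st_Gamma p t \<and>
        st_beta p t s =
          (if s = 1 then \<alpha> / 4 * (st_W p t * st_Gamma p t * M)
           else \<alpha> / 4 * (st_W p t * st_Gamma p t * M + (real s - 2))) \<and>
        st_gamma p t s = 4 / \<alpha> * M\<^sup>2 * st_Gamma p t / st_delta p t s) \<and>
     st_W p (t + 1) = st_delta p t (st_S p t) / M"

definition sc_weight :: "steps \<Rightarrow> nat \<Rightarrow> nat \<Rightarrow> real" where
  "sc_weight p t s = st_omega p t * st_delta p t s / (\<Sum>s' = 1..st_S p t. st_delta p t s')"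

definition sc_extrapolation :: "steps \<Rightarrow> bool" where
  "sc_extrapolation p \<longleftrightarrow>
     (\<forall>t\<ge>1. \<forall>s\<in>{2..st_S p t}. st_rho p t s = st_delta p t (s - 1) / st_delta p t s) \<and>
     (\<forall>t\<ge>2. st_rho p t 1 = sc_weight p (t - 1) (st_S p (t - 1)) / sc_weight p t 1)"

definition sc_rule :: "real \<Rightarrow> real \<Rightarrow> real \<Rightarrow> ('n::finite, 'm::finite) iterates \<Rightarrow> steps \<Rightarrow> bool" where
  "sc_rule \<alpha> L R r p \<longleftrightarrow>
     sc_outer \<alpha> L p \<and>
     sc_phase_first \<alpha> (R\<^sup>2 / (\<alpha> * L)) (nu_size r 1) p \<and>
     (\<forall>t\<ge>2. sc_phase_later \<alpha> (R\<^sup>2 / (\<alpha> * L)) (nu_size r t) p t) \<and>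
     sc_extrapolation p"

subsection \<open>Complexity\<close>

text \<open>Oracle calls are counted one per phase, so the number of phases is the number of calls;
  \<open>mv t s\<close> is the number of matrix-vector products spent in inner iteration \<open>s\<close> of phase
  \<open>t\<close>. At most three appear in the formulas of an inner iteration: one for the dual step, and one
  or (only if \<open>s = 1\<close> and \<open>t \<ge> 2\<close>) two for \<open>it_h\<close>.\<close>

definition oracle_count ::
  "(real^'n \<Rightarrow> bool) \<Rightarrow> steps \<Rightarrow> ('n::finite, 'm::finite) iterates \<Rightarrow> nat" where
  "oracle_count P p r = (LEAST N. 1 \<le> N \<and> P (acgd_output p r N))"

definition matvec_count ::
  "(nat \<Rightarrow> nat \<Rightarrow> nat) \<Rightarrow> (real^'n \<Rightarrow> bool) \<Rightarrow> steps \<Rightarrow> ('n::finite, 'm::finite) iterates \<Rightarrow> nat" where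
  "matvec_count mv P p r = (\<Sum>t = 1..oracle_count P p r. \<Sum>s = 1..st_S p t. mv t s)"

definition jacobian_bound ::
  "(real^'n \<Rightarrow> real^'m) \<Rightarrow> real^'n \<Rightarrow> (real^'n) set \<Rightarrow> real \<Rightarrow> bool" where
  "jacobian_bound g xs P M \<longleftrightarrow>
     (\<exists>B. bounded B \<and> xs \<in> interior B \<and> P \<subseteq> B \<and> (\<forall>x\<in>B. max 1 (opnorm (jac g x)) \<le> M))"

text \<open>The constant behind all \<open>O\<close>-bounds. It is a numeral, rather than existentially
  quantified inside the theorem, because dimensions are types here: an existential constant could
  depend on them, and would not be absolute.\<close>

definition abs_const :: real where
  "abs_const = 1000"

end

theory Submission
  imports Defs
begin

text \<open>
  Write \<open>\<Omega>\<^sub>N\<close> for the sum of the first \<open>N\<close> outer weights \<open>\<omega>\<^sub>t\<close> and \<open>z\<close> for the output after \<open>N\<close> phases.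
  Everything follows from one inequality (lemma \<open>gap_bound\<close>), valid for each multiplier \<open>\<lambda>\<close> in
  \<open>\<Lambda>\<^sub>c\<close>: the Lagrangian gap \<open>f z + \<lambda> \<bullet> g z + u z - F\<^sub>*\<close>, multiplied by \<open>\<Omega>\<^sub>N\<close>, plus a multiple of
  \<open>\<parallel>x\<^sup>N - x\<^sup>*\<parallel>\<^sup>2\<close>, is at most \<open>L \<parallel>x\<^sup>0 - x\<^sup>*\<parallel>\<^sup>2 + 2 L \<parallel>\<lambda>\<parallel>\<^sup>2 / R\<^sup>2\<close>, hence at most \<open>L A\<close>. Taking \<open>\<lambda> = 0\<close> bounds the
  objective gap. Taking \<open>\<lambda> = \<lambda>\<^sup>* + c v / \<parallel>v\<parallel>\<close> with \<open>v\<close> the positive part of \<open>g z\<close> bounds \<open>c \<parallel>v\<parallel>\<close>, because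
  the Lagrangian at \<open>\<lambda>\<^sup>*\<close> is never below \<open>F\<^sub>*\<close>. Taking \<open>\<lambda> = \<lambda>\<^sup>*\<close> bounds \<open>\<parallel>x\<^sup>N - x\<^sup>*\<parallel>\<close>, and so the points
  where the oracle is called. Thus a phase with \<open>\<Omega>\<^sub>N \<ge> L A / \<epsilon>\<close> ends the run.

  The inequality adds up two estimates. The outer loop is an accelerated gradient method for
  \<open>f + \<lambda> \<bullet> g\<close>: replacing this function by its linearisations at the oracle points costs at most the
  sum of \<open>\<omega>\<^sub>t \<eta>\<^sub>t / 2 \<parallel>x\<^sup>t - x\<^sup>t\<^sup>-\<^sup>1\<parallel>\<^sup>2\<close> (\<open>sum_lin_error_le\<close>), since the Bregman distances from the oracle
  points to \<open>z\<close> telescope. The inner loop is a primal-dual method for the linearised saddle problem: one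
  potential decreases along all inner iterations, across the borders between phases as well
  (\<open>inner_potential\<close>, \<open>pre_phase\<close>, \<open>sum_phase_gap_le\<close>). The proximal term of the subproblems pays the
  cost of the outer loop. Half of the modulus \<open>\<alpha>\<close> pays for the growth of the weighted \<open>\<beta>\<close>, the
  other half for the growth of \<open>\<omega>\<^sub>t \<eta>\<^sub>t\<close>.

  The number of phases is then a matter of growth: with \<open>\<sigma> = sqrt (2 \<kappa>)\<close>, the weights grow at least
  by the factor \<open>1 + 1 / (2 \<sigma>)\<close> per phase, so \<open>\<Omega>\<^sub>N\<close> reaches \<open>L A / \<epsilon> = sqrt \<kappa> E\<close> with
  \<open>E = sqrt (L \<alpha>) A / \<epsilon>\<close> within \<open>8 \<sigma> ln E + 1\<close> phases (\<open>Omega_large\<close>).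

  The inner iterations must not be counted phase by phase, each against its own
  target, which would lose a power of \<open>\<kappa>\<close>. The
  carried weight \<open>W\<close> links the phases: \<open>S\<^sub>t - 2\<close> is at most \<open>3 M\<^sub>t\<close> times the increase of \<open>W\<close> in phase
  \<open>t\<close> (\<open>S_le\<close>, with \<open>W\<^sub>1 = 0\<close>), while \<open>W\<^sup>2\<close> increases at most by \<open>2 \<Delta> \<omega>\<^sub>t\<close> (\<open>W_growth\<close>). Hence all
  phases together take at most \<open>2 N + 3 M sqrt (2 \<Delta> \<Omega>\<^sub>N)\<close> inner iterations. Since the phase before the
  last one did not meet the criterion, and \<open>\<Omega>\<close> at most triples in a phase, \<open>\<Omega>\<^sub>N\<close> is at most
  \<open>3 L A / \<epsilon>\<close> at the end.
\<close>

section \<open>Gradients and strong convexity\<close>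

lemma GDERIV_unique:
  assumes "GDERIV f x :> D" "GDERIV f x :> E"
  shows "D = E"
proof -
  have "(\<lambda>h. h \<bullet> D) = (\<lambda>h. h \<bullet> E)"
    using has_derivative_unique assms unfolding gderiv_def by blast
  then show ?thesis by (simp add: fun_eq_iff vector_eq_ldot)
qed

lemma GDERIV_imp_grad_eq: "GDERIV f x :> D \<Longrightarrow> grad f x = D"
  unfolding grad_def by (blast intro: the_equality GDERIV_unique)

lemma GDERIV_grad:
  fixes f :: "'a::euclidean_space \<Rightarrow> real"
  assumes "f differentiable (at x)"
  shows "GDERIV f x :> grad f x"
proof -
  obtain D where D: "(f has_derivative D) (at x)"
    using assms by (auto simp: differentiable_def)
  have "linear D" using D by (rule has_derivative_linear)
  then have "D = (\<lambda>h. h \<bullet> adjoint D 1)"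
    by (simp add: adjoint_works)
  then have "GDERIV f x :> adjoint D 1"
    using D by (simp add: gderiv_def)
  then show ?thesis using GDERIV_imp_grad_eq by metis
qed

lemma GDERIV_DERIV_line:
  assumes "GDERIV f (a + t *\<^sub>R d) :> D"
  shows "((\<lambda>t. f (a + t *\<^sub>R d)) has_real_derivative d \<bullet> D) (at t)"
proof -
  have 1: "((\<lambda>t. a + t *\<^sub>R d) has_derivative (\<lambda>h. h *\<^sub>R d)) (at t)"
    by (auto intro!: derivative_eq_intros)
  have "((\<lambda>t. f (a + t *\<^sub>R d)) has_derivative (\<lambda>h. (h *\<^sub>R d) \<bullet> D)) (at t)"
    using has_derivative_compose[OF 1] assms unfolding gderiv_def by blast
  then show ?thesis
    by (simp add: has_field_derivative_def mult_commute_abs)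
qed

text \<open>The one-dimensional tangent inequality, applied along the line from \<open>x\<close> to \<open>y\<close>.\<close>

lemma convex_on_above_gradient:
  assumes cvx: "convex_on UNIV f" and D: "GDERIV f x :> D"
  shows "f x + D \<bullet> (y - x) \<le> f y"
proof -
  let ?h = "\<lambda>t. f (x + t *\<^sub>R (y - x))"
  have "convex_on UNIV ?h"
  proof (rule convex_onI)
    fix t a b :: real
    assume "0 < t" "t < 1"
    have e: "x + ((1 - t) *\<^sub>R a + t *\<^sub>R b) *\<^sub>R (y - x)
        = (1 - t) *\<^sub>R (x + a *\<^sub>R (y - x)) + t *\<^sub>R (x + b *\<^sub>R (y - x))"
      by (simp add: algebra_simps)
    show "?h ((1 - t) *\<^sub>R a + t *\<^sub>R b) \<le> (1 - t) * ?h a + t * ?h b"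
      unfolding e by (rule convex_onD[OF cvx]) (use \<open>0 < t\<close> \<open>t < 1\<close> in auto)
  qed auto
  moreover have "(?h has_real_derivative (y - x) \<bullet> D) (at 0)"
    using GDERIV_DERIV_line[of f x 0 "y - x"] D by simp
  ultimately have "?h 1 - ?h 0 \<ge> (y - x) \<bullet> D * (1 - 0)"
    by (intro convex_on_imp_above_tangent[where A = UNIV]) auto
  then show ?thesis by (simp add: inner_commute)
qed

text \<open>Along the segment from \<open>x\<close> to \<open>y\<close>, the difference between \<open>f\<close> and the quadratic bound has a
  nonpositive derivative, by the Lipschitz condition.\<close>

lemma lipschitz_gradient_upper_bound:
  assumes D: "\<And>x. GDERIV f x :> G x" and lip: "L-lipschitz_on UNIV G"
  shows "f y \<le> f x + G x \<bullet> (y - x) + L / 2 * (norm (y - x))\<^sup>2"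
proof -
  define d where "d = y - x"
  define h where "h = (\<lambda>t. f (x + t *\<^sub>R d) - t * (G x \<bullet> d) - L / 2 * (norm d)\<^sup>2 * t\<^sup>2)"
  have "h 1 \<le> h 0"
  proof (rule DERIV_nonpos_imp_nonincreasing[where f = h and a = 0 and b = 1])
    fix t :: real assume t: "0 \<le> t" "t \<le> 1"
    let ?D = "d \<bullet> G (x + t *\<^sub>R d) - G x \<bullet> d - L * (norm d)\<^sup>2 * t"
    have "(h has_real_derivative ?D) (at t)"
      unfolding h_def by (auto intro!: derivative_eq_intros GDERIV_DERIV_line D)
    moreover have "?D \<le> 0"
    proof -
      have "norm (G (x + t *\<^sub>R d) - G x) \<le> L * norm (t *\<^sub>R d)"
        using lipschitz_onD[OF lip, of "x + t *\<^sub>R d" x] by (simp add: dist_norm)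
      then have "norm (G (x + t *\<^sub>R d) - G x) * norm d \<le> L * (t * norm d) * norm d"
        using t by (intro mult_right_mono) auto
      moreover have "(G (x + t *\<^sub>R d) - G x) \<bullet> d \<le> norm (G (x + t *\<^sub>R d) - G x) * norm d"
        by (rule norm_cauchy_schwarz)
      ultimately show ?thesis
        by (simp add: inner_diff_left inner_diff_right inner_commute power2_eq_square algebra_simps)
    qed
    ultimately show "\<exists>D. (h has_real_derivative D) (at t) \<and> D \<le> 0" by blast
  qed simp
  then show ?thesis by (simp add: h_def d_def)
qed

text \<open>A gradient step from \<open>w\<close> for the function \<open>f\<close> minus its tangent at \<open>z\<close> decreases that function by
  at least the left-hand side, and it cannot fall below its minimum, which is attained at \<open>z\<close>. The
  constant is relaxed from \<open>L\<close> to \<open>L'\<close> so that one bound serves all multipliers.\<close>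

lemma bregman_ge_gradient_distance:
  assumes D: "\<And>x. GDERIV f x :> G x" and cvx: "convex_on UNIV f"
    and lip: "L-lipschitz_on UNIV G" and "L \<le> L'" "0 < L'"
  shows "(norm (G w - G z))\<^sup>2 / (2 * L') \<le> f w - f z - G z \<bullet> (w - z)"
proof -
  have lip': "L'-lipschitz_on UNIV G" using lip \<open>L \<le> L'\<close> by (rule lipschitz_on_le)
  define e where "e = G w - G z"
  define v where "v = w - e /\<^sub>R L'"
  have 1: "f z + G z \<bullet> (v - z) \<le> f v"
    by (rule convex_on_above_gradient[OF cvx D])
  have 2: "f v \<le> f w + G w \<bullet> (v - w) + L' / 2 * (norm (v - w))\<^sup>2"
    by (rule lipschitz_gradient_upper_bound[OF D lip'])
  have 3: "v - w = - (e /\<^sub>R L')" "v - z = (w - z) - e /\<^sub>R L'" by (simp_all add: v_def)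
  have 4: "L' / 2 * (norm (v - w))\<^sup>2 = (norm e)\<^sup>2 / (2 * L')"
    using \<open>0 < L'\<close> unfolding 3 by (simp add: power_mult_distrib power2_eq_square field_simps)
  have 5: "G w \<bullet> (v - w) = - (G w \<bullet> e) / L'" "G z \<bullet> (v - z) = G z \<bullet> (w - z) - (G z \<bullet> e) / L'"
    unfolding 3 by (simp_all add: inner_diff_right divide_inverse_commute)
  have 6: "(norm e)\<^sup>2 = G w \<bullet> e - G z \<bullet> e"
    by (simp add: e_def power2_norm_eq_inner inner_diff_left)
  have "(norm e)\<^sup>2 / (2 * L') = (norm e)\<^sup>2 / L' - (norm e)\<^sup>2 / (2 * L')"
    using \<open>0 < L'\<close> by (simp add: field_simps)
  moreover have "(norm e)\<^sup>2 / L' = (G w \<bullet> e) / L' - (G z \<bullet> e) / L'"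
    by (simp add: 6 diff_divide_distrib)
  ultimately show ?thesis using 1 2 unfolding 4 5 e_def by linarith
qed

lemma norm_convex_combination_diff_power2:
  fixes x y a :: "'a::real_inner"
  shows "(norm ((1 - t) *\<^sub>R x + t *\<^sub>R y - a))\<^sup>2
    = (1 - t) * (norm (x - a))\<^sup>2 + t * (norm (y - a))\<^sup>2 - t * (1 - t) * (norm (x - y))\<^sup>2"
  unfolding power2_norm_eq_inner
  by (simp add: inner_diff_left inner_diff_right inner_add_left inner_add_right
      inner_commute algebra_simps)

lemma convex_on_norm_diff_power2:
  assumes "convex X"
  shows "convex_on X (\<lambda>y::'a::real_inner. (norm (y - a))\<^sup>2)"
proof (rule convex_onI[OF _ assms])
  fix t :: real and x y :: 'a
  assume "0 < t" "t < 1"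
  then have "0 \<le> t * (1 - t) * (norm (x - y))\<^sup>2" by simp
  then show "(norm ((1 - t) *\<^sub>R x + t *\<^sub>R y - a))\<^sup>2
      \<le> (1 - t) * (norm (x - a))\<^sup>2 + t * (norm (y - a))\<^sup>2"
    unfolding norm_convex_combination_diff_power2 by linarith
qed

lemma strongly_convex_on_quadratic:
  assumes "convex X"
  shows "strongly_convex_on X m (\<lambda>y::'a::real_inner. m / 2 * (norm (y - a))\<^sup>2)"
  using assms unfolding strongly_convex_on_def norm_convex_combination_diff_power2
  by (simp add: field_simps)

lemma strongly_convex_on_add:
  assumes "strongly_convex_on X m f" "strongly_convex_on X k h"
  shows "strongly_convex_on X (m + k) (\<lambda>y. f y + h y)"
  unfolding strongly_convex_on_def
proof (intro conjI ballI)
  show "convex X" using assms(1) by (simp add: strongly_convex_on_def)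
  fix x y and t :: real assume *: "x \<in> X" "y \<in> X" "t \<in> {0..1}"
  have "f ((1 - t) *\<^sub>R x + t *\<^sub>R y)
          \<le> (1 - t) * f x + t * f y - m / 2 * t * (1 - t) * (norm (x - y))\<^sup>2"
    "h ((1 - t) *\<^sub>R x + t *\<^sub>R y)
          \<le> (1 - t) * h x + t * h y - k / 2 * t * (1 - t) * (norm (x - y))\<^sup>2"
    using assms * by (simp_all add: strongly_convex_on_def)
  then show "f ((1 - t) *\<^sub>R x + t *\<^sub>R y) + h ((1 - t) *\<^sub>R x + t *\<^sub>R y)
      \<le> (1 - t) * (f x + h x) + t * (f y + h y) - (m + k) / 2 * t * (1 - t) * (norm (x - y))\<^sup>2"
    by (simp add: algebra_simps add_divide_distrib)
qed

lemma strongly_convex_on_inner: "convex X \<Longrightarrow> strongly_convex_on X 0 (\<lambda>y. a \<bullet> y)"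
  by (simp add: strongly_convex_on_def inner_add_right)

text \<open>Compare the minimiser \<open>y\<close> with the points \<open>(1 - t) y + t z\<close> and let \<open>t\<close> tend to 0. Both
  proximal steps of the method enter the analysis through this three-point inequality.\<close>

lemma strongly_convex_argmin_growth:
  assumes sc: "strongly_convex_on X m J" and y: "is_arg_min J (\<lambda>y. y \<in> X) y" and z: "z \<in> X"
  shows "J y + m / 2 * (norm (z - y))\<^sup>2 \<le> J z"
proof -
  have yX: "y \<in> X" and min: "\<And>v. v \<in> X \<Longrightarrow> J y \<le> J v"
    using y by (force simp: is_arg_min_def)+
  let ?e = "m / 2 * (norm (z - y))\<^sup>2"
  have 1: "J y + (1 - t) * ?e \<le> J z" if t: "0 < t" "t < 1" for t
  proof -
    have "(1 - t) *\<^sub>R y + t *\<^sub>R z \<in> X"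
      using sc yX z t by (auto simp: strongly_convex_on_def convex_alt)
    then have "J y \<le> J ((1 - t) *\<^sub>R y + t *\<^sub>R z)" by (rule min)
    also have "\<dots> \<le> (1 - t) * J y + t * J z - m / 2 * t * (1 - t) * (norm (y - z))\<^sup>2"
      using sc yX z t by (auto simp: strongly_convex_on_def)
    finally have "t * (J y + (1 - t) * ?e) \<le> t * J z"
      by (simp add: algebra_simps norm_minus_commute)
    then show ?thesis using t by simp
  qed
  have "((\<lambda>t. J y + (1 - t) * ?e) \<longlongrightarrow> J y + (1 - 0) * ?e) (at_right 0)"
    by (intro tendsto_intros)
  moreover have "eventually (\<lambda>t. J y + (1 - t) * ?e \<le> J z) (at_right (0::real))"
    using 1 by (auto simp: eventually_at_right_field intro!: exI[of _ 1])
  ultimately have "J y + (1 - 0) * ?e \<le> J z"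
    by (intro tendsto_upperbound) auto
  then show ?thesis by simp
qed

lemma inner_le_sum_squares:
  fixes a b :: "'a::real_inner"
  assumes "0 < k"
  shows "a \<bullet> b \<le> (norm a)\<^sup>2 / (2 * k) + k / 2 * (norm b)\<^sup>2"
proof -
  have "0 \<le> (norm (a - k *\<^sub>R b))\<^sup>2" by simp
  also have "\<dots> = (norm a)\<^sup>2 - 2 * k * (a \<bullet> b) + k\<^sup>2 * (norm b)\<^sup>2"
    unfolding power2_norm_eq_inner
    by (simp add: inner_diff_left inner_diff_right inner_commute power2_eq_square algebra_simps)
  finally show ?thesis using assms by (simp add: field_simps power2_eq_square)
qed

section \<open>Matrices and the nonnegative orthant\<close>

lemma inner_transpose: "(transpose A *v l) \<bullet> v = l \<bullet> (A *v v)" for A :: "real^'n^'m"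
  by (simp add: dot_lmul_matrix)

lemma transpose_mult_diff:
  "transpose A *v (k - l) = transpose A *v k - transpose A *v l" for A :: "real^'n^'m"
  by (rule matrix_vector_mult_diff_distrib)

lemma norm_mult_le_opnorm: "norm (A *v v) \<le> opnorm A * norm v"
  unfolding opnorm_def by (rule onorm) (rule matrix_vector_mul_bounded_linear)

lemma inner_nonneg_orthant_mono:
  fixes l a b :: "real^'m"
  assumes "l \<in> nonneg_orthant" "\<And>i. a $ i \<le> b $ i"
  shows "l \<bullet> a \<le> l \<bullet> b"
  unfolding inner_vec_def using assms by (auto simp: nonneg_orthant_def intro!: sum_mono mult_left_mono)

text \<open>This is how the two proximal terms absorb the pairing of a dual increment of length \<open>D\<close> with a
  primal vector of length \<open>V\<close>. The hypothesis says that the quadratic form in \<open>V\<close> and \<open>D\<close> is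
  nonnegative.\<close>

lemma coupled_product_le:
  fixes k a c D V :: real
  assumes "0 < c" "k\<^sup>2 \<le> a * c"
  shows "k * D * V \<le> a / 2 * V\<^sup>2 + c / 2 * D\<^sup>2"
proof -
  have "k\<^sup>2 * V\<^sup>2 \<le> a * c * V\<^sup>2" by (rule mult_right_mono[OF assms(2)]) simp
  moreover have "0 \<le> (k * V - c * D)\<^sup>2" by simp
  ultimately have "c * (2 * (k * D * V)) \<le> c * (a * V\<^sup>2 + c * D\<^sup>2)"
    by (simp add: power2_eq_square algebra_simps)
  then show ?thesis using assms(1) by simp
qed

section \<open>Growth of the outer weights\<close>

text \<open>The rule for the step sizes sees the iterates only through the norms \<open>M t\<close> of the Jacobians, so its
  consequences can be derived for an arbitrary positive sequence.\<close>

locale sc_steps =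
  fixes \<alpha> L R :: real and M :: "nat \<Rightarrow> real" and p :: steps
  assumes alpha_pos: "0 < \<alpha>" and alpha_le_L: "\<alpha> \<le> L" and R_pos: "0 < R"
    and M_pos: "\<And>t. 0 < M t"
    and outer: "sc_outer \<alpha> L p"
    and phase_first: "sc_phase_first \<alpha> (R\<^sup>2 / (\<alpha> * L)) (M 1) p"
    and phase_later: "\<And>t. 2 \<le> t \<Longrightarrow> sc_phase_later \<alpha> (R\<^sup>2 / (\<alpha> * L)) (M t) p t"
    and extrapolation: "sc_extrapolation p"
begin

definition "\<Delta> = R\<^sup>2 / (\<alpha> * L)"

definition "\<sigma> = sqrt (2 * (L / \<alpha>))"

lemma L_pos: "0 < L" using alpha_pos alpha_le_L by linarith

lemma Delta_pos: "0 < \<Delta>"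
  using alpha_pos L_pos R_pos by (simp add: \<Delta>_def)

lemma sigma_ge_1: "1 \<le> \<sigma>"
proof -
  have "1 \<le> L / \<alpha>" using alpha_pos alpha_le_L by simp
  then show ?thesis by (simp add: \<sigma>_def)
qed

lemma sigma_power2: "\<sigma>\<^sup>2 = 2 * L / \<alpha>"
  using alpha_pos L_pos by (simp add: \<sigma>_def)

lemma tau_eq: "st_tau p t = min ((real t - 1) / 2) \<sigma>"
  using outer by (simp add: sc_outer_def \<sigma>_def)

lemma tau_1: "st_tau p 1 = 0" and tau_2: "st_tau p 2 = 1 / 2"
  using sigma_ge_1 by (simp_all add: tau_eq)

lemma tau_nonneg: "1 \<le> t \<Longrightarrow> 0 \<le> st_tau p t"
  using sigma_ge_1 by (simp add: tau_eq)

lemma tau_pos: "2 \<le> t \<Longrightarrow> 0 < st_tau p t"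
  using sigma_ge_1 by (simp add: tau_eq)

lemma tau_mono: "st_tau p t \<le> st_tau p (Suc t)"
  by (simp add: tau_eq min_def)

lemma tau_Suc_le: "st_tau p (Suc t) \<le> st_tau p t + 1 / 2"
proof -
  have "(real (Suc t) - 1) / 2 = (real t - 1) / 2 + 1 / 2" by (simp add: field_simps)
  moreover have "min (x + 1 / 2) \<sigma> \<le> min x \<sigma> + 1 / 2" for x by (simp add: min_def)
  ultimately show ?thesis unfolding tau_eq by metis
qed

lemma tau_le_sigma: "st_tau p t \<le> \<sigma>"
  by (simp add: tau_eq)

lemma eta_eq: "1 \<le> t \<Longrightarrow> st_eta p t = L / st_tau p (Suc t)"
  using outer by (simp add: sc_outer_def)

lemma eta_pos: "1 \<le> t \<Longrightarrow> 0 < st_eta p t"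
  using tau_pos[of "Suc t"] L_pos by (simp add: eta_eq)

lemma eta_1: "st_eta p 1 = 2 * L"
proof -
  have "st_tau p (Suc 1) = 1 / 2" using tau_2 by (simp add: numeral_2_eq_2)
  then have "st_eta p 1 = L / (1 / 2)" unfolding eta_eq[OF order_refl] by (rule arg_cong)
  then show ?thesis by simp
qed

lemma theta_eq: "st_theta p (Suc t) = st_tau p (Suc t) / (st_tau p t + 1)"
  using outer by (simp add: sc_outer_def)

lemma theta_1: "st_theta p 1 = 0"
  using theta_eq[of 0] tau_1 by simp

lemma theta_nonneg: "1 \<le> t \<Longrightarrow> 0 \<le> st_theta p (Suc t)"
  using tau_nonneg[of t] tau_nonneg[of "Suc t"] by (simp add: theta_eq)

lemma theta_le_1: "1 \<le> t \<Longrightarrow> st_theta p (Suc t) \<le> 1"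
  using tau_nonneg[of t] tau_Suc_le[of t] by (simp add: theta_eq divide_le_eq_1)

lemma omega_1: "st_omega p 1 = 1"
  using outer by (simp add: sc_outer_def)

lemma omega_Suc:
  assumes "1 \<le> t"
  shows "st_omega p (Suc t) = st_omega p t * ((1 + st_tau p t) / st_tau p (Suc t))"
proof -
  have "st_omega p (Suc t) = st_omega p t / st_theta p (Suc t)"
    using outer assms by (simp add: sc_outer_def)
  then show ?thesis by (simp add: theta_eq add.commute)
qed

lemma omega_pos: "1 \<le> t \<Longrightarrow> 0 < st_omega p t"
proof (induction t rule: dec_induct)
  case base
  then show ?case by (simp add: omega_1[simplified])
next
  case (step t)
  have "0 < st_tau p (Suc t)" "0 \<le> st_tau p t"
    using tau_pos[of "Suc t"] tau_nonneg[of t] step by auto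
  then have "0 < (1 + st_tau p t) / st_tau p (Suc t)" by (intro divide_pos_pos) linarith+
  then show ?case unfolding omega_Suc[OF step(1)] by (rule mult_pos_pos[OF step.IH])
qed

lemma omega_tau: "1 \<le> t \<Longrightarrow> st_omega p (Suc t) * st_tau p (Suc t) = st_omega p t * (1 + st_tau p t)"
  using tau_pos[of "Suc t"] by (simp add: omega_Suc)

lemma omega_theta:
  assumes "1 \<le> t" shows "st_omega p (Suc t) * st_theta p (Suc t) = st_omega p t"
proof -
  have "st_tau p t + 1 \<noteq> 0" using tau_nonneg[OF assms] by linarith
  moreover have "st_tau p (Suc t) \<noteq> 0" using tau_pos[of "Suc t"] assms by simp
  ultimately show ?thesis by (simp add: omega_Suc[OF assms] theta_eq add.commute)
qed

text \<open>Since \<open>\<tau>\<close> increases by at most \<open>1/2\<close> and stays below \<open>\<sigma>\<close>, the ratio \<open>(1 + \<tau>\<^sub>t) / \<tau>\<^sub>t\<^sub>+\<^sub>1\<close> of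
  consecutive weights is at least \<open>1 + 1 / (2 \<tau>\<^sub>t\<^sub>+\<^sub>1)\<close>. The resulting factor covers the early phases, where \<open>\<omega>\<^sub>t = t\<close>, and
  the later ones, where \<open>\<tau> = \<sigma>\<close>, alike.\<close>

lemma omega_Suc_ge:
  assumes "1 \<le> t" shows "st_omega p t * (1 + 1 / (2 * \<sigma>)) \<le> st_omega p (Suc t)"
proof -
  let ?a = "st_tau p (Suc t)"
  have a: "0 < ?a" "?a \<le> \<sigma>" using tau_pos[of "Suc t"] tau_le_sigma assms by auto
  have "1 + 1 / (2 * \<sigma>) \<le> 1 + 1 / (2 * ?a)"
    using a by (intro add_left_mono divide_left_mono) auto
  also have "\<dots> = (?a + 1 / 2) / ?a" using a by (simp add: field_simps)
  also have "\<dots> \<le> (1 + st_tau p t) / ?a"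
    using a tau_Suc_le[of t] by (intro divide_right_mono) linarith+
  finally show ?thesis
    unfolding omega_Suc[OF assms] using omega_pos[OF assms] by (intro mult_left_mono) auto
qed

lemma omega_ge_power: "(1 + 1 / (2 * \<sigma>)) ^ t \<le> st_omega p (Suc t)"
proof (induction t)
  case 0
  then show ?case by (simp add: omega_1[simplified])
next
  case (Suc t)
  have "0 \<le> 1 + 1 / (2 * \<sigma>)" using sigma_ge_1 by simp
  then have "(1 + 1 / (2 * \<sigma>)) ^ t * (1 + 1 / (2 * \<sigma>)) \<le> st_omega p (Suc t) * (1 + 1 / (2 * \<sigma>))"
    using Suc by (intro mult_right_mono)
  also have "\<dots> \<le> st_omega p (Suc (Suc t))" by (rule omega_Suc_ge) simp
  finally show ?case by (simp add: mult.commute)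
qed

lemma omega_ge_1: "1 \<le> st_omega p (Suc t)"
proof -
  have "1 \<le> 1 + 1 / (2 * \<sigma>)" using sigma_ge_1 by simp
  then have "1 \<le> (1 + 1 / (2 * \<sigma>)) ^ t" by (rule one_le_power)
  then show ?thesis using omega_ge_power[of t] by linarith
qed

lemma omega_Suc_le:
  assumes "1 \<le> t" shows "st_omega p (Suc t) \<le> 2 * st_omega p t"
proof -
  let ?a = "st_tau p (Suc t)"
  have "1 + st_tau p t \<le> 2 * ?a"
  proof (cases "t = 1")
    case True then show ?thesis using tau_1 tau_2 by (simp add: numeral_2_eq_2)
  next
    case False
    then have "1 \<le> ?a" using sigma_ge_1 assms by (simp add: tau_eq)
    then show ?thesis using tau_mono[of t] by linarith
  qed
  then have "(1 + st_tau p t) / ?a \<le> 2"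
    using tau_pos[of "Suc t"] assms by (simp add: divide_le_eq)
  then show ?thesis
    unfolding omega_Suc[OF assms] mult.commute[of 2]
    using omega_pos[OF assms] by (intro mult_left_mono) auto
qed

text \<open>This makes the distances \<open>\<parallel>x\<^sup>t - x\<^sup>*\<parallel>\<^sup>2\<close> telescope in the outer loop. Before \<open>\<tau>\<close> reaches its cap \<open>\<sigma>\<close> the
  products \<open>\<omega>\<^sub>t \<eta>\<^sub>t\<close> do not grow at all; at the cap they grow, and the value \<open>\<sigma>\<^sup>2 = 2 L / \<alpha>\<close> is
  what lets half of the strong convexity pay for it.\<close>

lemma omega_eta:
  assumes "1 \<le> t"
  shows "st_omega p (Suc t) * st_eta p (Suc t) \<le> st_omega p t * (st_eta p t + \<alpha> / 2)"
proof -
  define a where "a = st_tau p t"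
  define b where "b = st_tau p (Suc t)"
  define c where "c = st_tau p (Suc (Suc t))"
  have pos: "0 < b" "0 < c" using tau_pos[of "Suc t"] tau_pos[of "Suc (Suc t)"] assms by (auto simp: b_def c_def)
  have key: "(a + 1) * \<sigma>\<^sup>2 \<le> c * \<sigma>\<^sup>2 + b * c"
  proof (cases "c < \<sigma>")
    case True
    then have "a + 1 \<le> c" by (auto simp: a_def c_def tau_eq min_def field_simps split: if_splits)
    then have "(a + 1) * \<sigma>\<^sup>2 \<le> c * \<sigma>\<^sup>2" by (intro mult_right_mono) auto
    then show ?thesis using pos by (simp add: add_increasing2)
  next
    case c: False
    then have c: "c = \<sigma>" using tau_le_sigma by (simp add: c_def order_antisym)
    have "(a + 1) * \<sigma> \<le> \<sigma> * \<sigma> + b"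
    proof (cases "b < \<sigma>")
      case False
      then have "b = \<sigma>" using tau_le_sigma by (simp add: b_def order_antisym)
      moreover have "a * \<sigma> \<le> \<sigma> * \<sigma>"
        using tau_le_sigma sigma_ge_1 by (intro mult_right_mono) (auto simp: a_def)
      ultimately show ?thesis by (simp add: algebra_simps)
    next
      case True
      then have b: "b = real t / 2" by (auto simp: b_def tau_eq min_def split: if_splits)
      have a: "a \<le> b - 1 / 2" by (simp add: a_def b tau_eq min_def field_simps)
      have c': "\<sigma> \<le> b + 1 / 2" using c unfolding c_def tau_eq b by (simp add: min_def field_simps split: if_splits)
      have "1 / 2 \<le> b" using assms b by simp
      have "(a + 1) * \<sigma> \<le> (b + 1 / 2) * \<sigma>"
        using a sigma_ge_1 by (intro mult_right_mono) auto
      moreover have "0 \<le> (\<sigma> - b) * (\<sigma> - 1 / 2) + b / 2"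
        using True sigma_ge_1 pos by (intro add_nonneg_nonneg mult_nonneg_nonneg) auto
      moreover have "(\<sigma> - b) * (\<sigma> - 1 / 2) + b / 2 = \<sigma> * \<sigma> + b - (b + 1 / 2) * \<sigma>"
        by (simp add: field_simps)
      ultimately show ?thesis by linarith
    qed
    then have "(a + 1) * \<sigma> * \<sigma> \<le> (\<sigma> * \<sigma> + b) * \<sigma>"
      using sigma_ge_1 by (intro mult_right_mono) auto
    then show ?thesis unfolding c by (simp add: algebra_simps power2_eq_square)
  qed
  have "(1 + a) / b * (L / c) \<le> L / b + \<alpha> / 2"
  proof -
    have "(a + 1) * (2 * L) \<le> c * (2 * L) + b * c * \<alpha>"
    proof -
      have e: "2 * L = \<sigma>\<^sup>2 * \<alpha>" using alpha_pos by (simp add: sigma_power2)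
      have "(a + 1) * \<sigma>\<^sup>2 * \<alpha> \<le> (c * \<sigma>\<^sup>2 + b * c) * \<alpha>"
        using key alpha_pos by (intro mult_right_mono) auto
      then show ?thesis unfolding e by (simp add: algebra_simps)
    qed
    then have "((a + 1) * (2 * L)) / (2 * b * c) \<le> (c * (2 * L) + b * c * \<alpha>) / (2 * b * c)"
      using pos by (intro divide_right_mono) auto
    moreover have "((a + 1) * (2 * L)) / (2 * b * c) = (1 + a) / b * (L / c)"
      "(c * (2 * L) + b * c * \<alpha>) / (2 * b * c) = L / b + \<alpha> / 2"
      using pos by (simp_all add: field_simps)
    ultimately show ?thesis by simp
  qed
  then have "st_omega p t * ((1 + a) / b * (L / c)) \<le> st_omega p t * (L / b + \<alpha> / 2)"
    using omega_pos[OF assms] by (intro mult_left_mono) auto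
  then show ?thesis using assms
    by (simp add: omega_Suc eta_eq a_def b_def c_def mult.assoc)
qed

section \<open>Inner step sizes\<close>

text \<open>The first phase differs from the later ones in two ways: it carries no weight, and its weights
  \<open>\<delta>\<close> start one increment higher. Recording the two differences in \<open>carried\<close> and \<open>first_offset\<close> gives all
  phases the same formulas.\<close>

definition "carried t = (if t = 1 then 0 else st_W p t * M t)"

definition "first_offset t = (if t = (1::nat) then 1 else 0 :: real)"

text \<open>The amount that the inner weights of phase \<open>t\<close> have to reach before the phase may end.\<close>

definition "target t = st_omega p t * (M t)\<^sup>2 * \<Delta>"

lemma target_pos: "1 \<le> t \<Longrightarrow> 0 < target t"
  using omega_pos M_pos[of t] Delta_pos by (simp add: target_def)

lemma sum_arith: "(\<Sum>s = 1..S. w + (real s - 1 + e)) = real S * w + (real S * (real S - 1) / 2 + e * real S)"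
  by (induction S) (simp_all add: field_simps)

lemma
  assumes "1 \<le> t"
  shows S_eq: "st_S p t = (LEAST S. 1 \<le> S \<and>
      target t \<le> (\<Sum>s = 1..S. carried t + (real s - 1 + first_offset t)))" (is ?S)
    and Gamma_pos: "0 < st_Gamma p t" (is ?Gpos)
    and Gamma_sum_eq: "(\<Sum>s = 1..st_S p t. st_Gamma p t * carried t + (real s - 1 + first_offset t))
      = (st_Gamma p t)\<^sup>2 * target t" (is ?G)
    and delta_eq: "s \<in> {1..st_S p t} \<Longrightarrow>
      st_delta p t s = carried t + (real s - 1 + first_offset t) / st_Gamma p t" (is "PROP ?d")
    and beta_eq: "s \<in> {1..st_S p t} \<Longrightarrow> st_beta p t s = \<alpha> / 4 * (carried t * st_Gamma p t
      + (if s = 1 then 0 else real s - 2 + first_offset t))" (is "PROP ?b")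
    and gamma_eq: "s \<in> {1..st_S p t} \<Longrightarrow>
      st_gamma p t s = 4 / \<alpha> * (M t)\<^sup>2 * st_Gamma p t / st_delta p t s" (is "PROP ?g")
    and W_Suc: "st_W p (Suc t) = st_delta p t (st_S p t) / M t" (is ?W)
proof -
  have "?S \<and> ?Gpos \<and> ?G \<and>
    (\<forall>s\<in>{1..st_S p t}. st_delta p t s = carried t + (real s - 1 + first_offset t) / st_Gamma p t \<and>
       st_beta p t s = \<alpha> / 4 * (carried t * st_Gamma p t
         + (if s = 1 then 0 else real s - 2 + first_offset t)) \<and>
       st_gamma p t s = 4 / \<alpha> * (M t)\<^sup>2 * st_Gamma p t / st_delta p t s) \<and> ?W"
  proof (cases "t = 1")
    case True
    note ph = phase_first[unfolded sc_phase_first_def, folded \<Delta>_def]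
    have S: "st_S p 1 = (LEAST S. 1 \<le> S \<and>
      target 1 \<le> (\<Sum>s = 1..S. carried 1 + (real s - 1 + first_offset 1)))"
      using ph by (simp add: target_def carried_def first_offset_def)
    have "1 \<le> st_S p 1 \<and>
      target 1 \<le> (\<Sum>s = 1..st_S p 1. carried 1 + (real s - 1 + first_offset 1))"
      unfolding S
    proof (rule LeastI)
      have "target 1 \<le> real (Suc (nat \<lceil>target 1\<rceil>))" by linarith
      also have "\<dots> \<le> (\<Sum>s = 1..Suc (nat \<lceil>target 1\<rceil>). real s)"
        by (rule member_le_sum) auto
      finally show "1 \<le> Suc (nat \<lceil>target 1\<rceil>) \<and> target 1
          \<le> (\<Sum>s = 1..Suc (nat \<lceil>target 1\<rceil>). carried 1 + (real s - 1 + first_offset 1))"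
        by (simp add: carried_def first_offset_def)
    qed
    then have "0 < (\<Sum>s = 1..st_S p 1. real s)"
      using target_pos[of 1] by (simp add: carried_def first_offset_def)
    then have "st_Gamma p 1 \<noteq> 0" using ph by auto
    then have "0 < st_Gamma p 1" using ph by simp
    with S True ph show ?thesis
      by (auto simp: target_def carried_def first_offset_def numeral_2_eq_2)
  next
    case False
    then have "2 \<le> t" using assms by simp
    from phase_later[OF this] show ?thesis
      using False by (auto simp: sc_phase_later_def \<Delta>_def target_def carried_def first_offset_def mult.commute mult.assoc mult.left_commute)
  qed
  then show ?S ?Gpos ?G "PROP ?d" "PROP ?b" "PROP ?g" ?W by auto
qed

lemma S_attains:
  assumes "1 \<le> t" "0 \<le> carried t"
  shows "1 \<le> st_S p t \<and>
    target t \<le> (\<Sum>s = 1..st_S p t. carried t + (real s - 1 + first_offset t))"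
proof -
  define n where "n = nat \<lceil>target t\<rceil> + 2"
  have "target t \<le> real n - 1" unfolding n_def by linarith
  also have "\<dots> \<le> real n * (real n - 1) / 2"
  proof -
    have "2 * (real n - 1) \<le> real n * (real n - 1)" by (intro mult_right_mono) (auto simp: n_def)
    moreover have "2 * x \<le> y \<Longrightarrow> x \<le> y / 2" for x y :: real by simp
    ultimately show ?thesis by blast
  qed
  also have "\<dots> \<le> (\<Sum>s = 1..n. carried t + (real s - 1 + first_offset t))"
    unfolding sum_arith using assms(2) by (simp add: first_offset_def)
  finally have "1 \<le> n \<and> target t \<le> (\<Sum>s = 1..n. carried t + (real s - 1 + first_offset t))"
    by (simp add: n_def)
  then show ?thesis unfolding S_eq[OF assms(1)] by (rule LeastI)
qed

lemma carried_nonneg: "1 \<le> t \<Longrightarrow> 0 \<le> carried t"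
proof (induction t rule: dec_induct)
  case base
  then show ?case by (simp add: carried_def)
next
  case (step t)
  have "0 \<le> st_delta p t (st_S p t)"
    using delta_eq[of t "st_S p t"] S_attains[of t] Gamma_pos[of t] step by (simp add: first_offset_def)
  then show ?case using W_Suc[of t] step M_pos[of t] M_pos[of "Suc t"] by (simp add: carried_def)
qed

lemma
  assumes "1 \<le> t"
  shows S_ge_1: "1 \<le> st_S p t"
    and S_reaches: "target t \<le> real (st_S p t) * carried t
      + (real (st_S p t) * (real (st_S p t) - 1) / 2 + first_offset t * real (st_S p t))"
  using S_attains[OF assms carried_nonneg[OF assms]] unfolding sum_arith by auto

lemma S_minimal:
  assumes "1 \<le> t" "2 \<le> st_S p t"
  shows "(real (st_S p t) - 1) * carried t
      + ((real (st_S p t) - 1) * (real (st_S p t) - 2) / 2 + first_offset t * (real (st_S p t) - 1))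
    < target t"
proof -
  let ?P = "\<lambda>S. 1 \<le> S \<and> target t \<le> (\<Sum>s = 1..S. carried t + (real s - 1 + first_offset t))"
  have "\<not> ?P (st_S p t - 1)"
    by (rule not_less_Least) (use assms(2) in \<open>simp flip: S_eq[OF assms(1), simplified]\<close>)
  moreover have "real (st_S p t - 1) = real (st_S p t) - 1" using assms(2) by simp
  moreover have "real (st_S p t) - 1 - 1 = real (st_S p t) - 2" by simp
  ultimately show ?thesis
    using assms(2) unfolding sum_arith by (simp only:) auto
qed

lemma Gamma_eq:
  assumes "1 \<le> t"
  shows "st_Gamma p t * (real (st_S p t) * carried t)
      + (real (st_S p t) * (real (st_S p t) - 1) / 2 + first_offset t * real (st_S p t))
      = (st_Gamma p t)\<^sup>2 * target t"
  using Gamma_sum_eq[OF assms] unfolding sum_arith by (simp add: algebra_simps)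

lemma offset_nonneg: "0 \<le> first_offset t" by (simp add: first_offset_def)

text \<open>At \<open>\<Gamma> = 1\<close> the equation for \<open>\<Gamma>\<close> would require the sum of the increments to equal the target
  exactly, whereas \<open>S\<close> is chosen such that the sum reaches or exceeds it; \<open>\<Gamma>\<close> grows to make up
  for the excess.\<close>

lemma Gamma_ge_1:
  assumes "1 \<le> t" shows "1 \<le> st_Gamma p t"
proof (rule ccontr)
  let ?G = "st_Gamma p t"
  define a where "a = real (st_S p t) * carried t"
  define b where "b = real (st_S p t) * (real (st_S p t) - 1) / 2 + first_offset t * real (st_S p t)"
  assume "\<not> 1 \<le> ?G"
  then have G: "0 < ?G" "?G < 1" using Gamma_pos[OF assms] by auto
  have nn: "0 \<le> a" "0 \<le> b"
    using carried_nonneg[OF assms] S_ge_1[OF assms] offset_nonneg[of t] by (auto simp: a_def b_def)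
  have eq: "?G * a + b = ?G\<^sup>2 * target t" using Gamma_eq[OF assms] by (simp add: a_def b_def)
  have "?G\<^sup>2 * target t \<le> ?G\<^sup>2 * (a + b)"
    using S_reaches[OF assms] by (intro mult_left_mono) (auto simp: a_def b_def)
  then have le: "?G * (1 - ?G) * a + (1 - ?G\<^sup>2) * b \<le> 0"
    using eq by (simp add: algebra_simps power2_eq_square)
  have c: "0 < ?G * (1 - ?G)" "0 < 1 - ?G\<^sup>2"
    using G by (auto simp: abs_square_less_1)
  have "0 \<le> ?G * (1 - ?G) * a" "0 \<le> (1 - ?G\<^sup>2) * b" using c nn by auto
  then have "?G * (1 - ?G) * a = 0" "(1 - ?G\<^sup>2) * b = 0" using le by linarith+
  then have "a = 0" "b = 0" using c by auto
  then have "?G\<^sup>2 * target t = 0" using eq by simp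
  then show False using G target_pos[OF assms] by simp
qed

text \<open>Since \<open>S - 1\<close> iterations do not suffice, the excess is limited: going from \<open>S - 1\<close> to \<open>S\<close>
  terms enlarges the sum at most by the factor 3, the largest value of \<open>S / (S - 2)\<close> for \<open>S \<ge> 3\<close>.\<close>

lemma Gamma_le_3:
  assumes "1 \<le> t" "3 \<le> st_S p t" shows "st_Gamma p t \<le> 3"
proof -
  let ?G = "st_Gamma p t"
  define S where "S = real (st_S p t)"
  have S: "3 \<le> S" using assms by (simp add: S_def)
  define a where "a = (S - 1) * carried t"
  define b where "b = (S - 1) * (S - 2) / 2 + first_offset t * (S - 1)"
  have G: "1 \<le> ?G" by (rule Gamma_ge_1[OF assms(1)])
  have nn: "0 \<le> a" using carried_nonneg[OF assms(1)] S by (simp add: a_def)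
  have min: "a + b < target t" using S_minimal assms by (simp add: a_def b_def S_def)
  have 1: "S * carried t \<le> 3 * a"
  proof -
    have "S * carried t \<le> (3 * (S - 1)) * carried t"
      using S carried_nonneg[OF assms(1)] by (intro mult_right_mono) auto
    then show ?thesis unfolding a_def by (simp only: mult.assoc)
  qed
  have 2: "S * (S - 1) / 2 + first_offset t * S \<le> 3 * b"
  proof -
    \<comment> \<open>the case \<open>S = 3\<close> is tight and determines the constant\<close>
    have "(S - 1) * S \<le> (S - 1) * (3 * (S - 2))" using S by (intro mult_left_mono) auto
    moreover have "first_offset t * S \<le> first_offset t * (3 * (S - 1))"
      using S offset_nonneg by (intro mult_left_mono) auto
    ultimately show ?thesis by (simp add: b_def field_simps)
  qed
  have "?G\<^sup>2 * target t \<le> ?G * (3 * a) + 3 * b"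
    unfolding Gamma_eq[OF assms(1), symmetric, folded S_def]
    using 1 2 G by (intro add_mono mult_left_mono) auto
  also have "3 * b \<le> ?G * (3 * b)"
    using G 2 S offset_nonneg[of t] mult_right_mono[of 1 ?G "3 * b"] by (simp add: b_def)
  finally have "?G\<^sup>2 * target t \<le> ?G * (3 * (a + b))" by (simp add: algebra_simps)
  also have "\<dots> \<le> ?G * (3 * target t)" using min G by (intro mult_left_mono) auto
  finally have "?G * (?G * target t) \<le> ?G * (3 * target t)" by (simp add: power2_eq_square mult.assoc)
  then show ?thesis using G target_pos[OF assms(1)] by simp
qed

text \<open>The \<open>\<delta>\<close> of the preceding inner iteration, with the carried weight in the place of the index 0.
  In these terms \<open>\<beta>\<close> has one formula for all iterations of all phases (\<open>beta_prev\<close>).\<close>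

definition "prev_delta t s = (if s = 1 then carried t else st_delta p t (s - 1))"

lemma
  assumes "1 \<le> t" "s \<in> {1..st_S p t}"
  shows prev_delta_le: "prev_delta t s \<le> st_delta p t s"
    and delta_le_prev: "st_delta p t s \<le> prev_delta t s + 1 / st_Gamma p t"
    and beta_prev: "st_beta p t s = \<alpha> / 4 * (st_Gamma p t * prev_delta t s)"
proof -
  have G: "0 < st_Gamma p t" by (rule Gamma_pos[OF assms(1)])
  have "prev_delta t s \<le> st_delta p t s \<and>
    st_delta p t s \<le> prev_delta t s + 1 / st_Gamma p t \<and>
    st_beta p t s = \<alpha> / 4 * (st_Gamma p t * prev_delta t s)"
  proof (cases "s = 1")
    case True
    then show ?thesis
      using delta_eq[OF assms] beta_eq[OF assms] carried_nonneg[OF assms(1)] G offset_nonneg[of t]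
      by (auto simp: prev_delta_def first_offset_def)
  next
    case False
    have s1: "s - 1 \<in> {1..st_S p t}" using False assms by auto
    have r: "real (s - 1) = real s - 1" "2 \<le> real s" using False assms by auto
    have d: "prev_delta t s = carried t + (real s - 2 + first_offset t) / st_Gamma p t"
      using delta_eq[OF assms(1) s1] False unfolding prev_delta_def r by simp
    define x where "x = real s - 2 + first_offset t"
    have "0 \<le> x / st_Gamma p t" using r(2) offset_nonneg[of t] G by (simp add: x_def)
    moreover have "(real s - 1 + first_offset t) / st_Gamma p t = x / st_Gamma p t + 1 / st_Gamma p t"
      by (simp add: x_def flip: add_divide_distrib)
    ultimately show ?thesis unfolding d beta_eq[OF assms] delta_eq[OF assms] x_def[symmetric]
      using carried_nonneg[OF assms(1)] G False by (simp add: distrib_left mult.commute)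
  qed
  then show "prev_delta t s \<le> st_delta p t s"
    "st_delta p t s \<le> prev_delta t s + 1 / st_Gamma p t"
    "st_beta p t s = \<alpha> / 4 * (st_Gamma p t * prev_delta t s)" by auto
qed

lemma prev_delta_Suc: "1 \<le> s \<Longrightarrow> prev_delta t (Suc s) = st_delta p t s"
  by (simp add: prev_delta_def)

lemma carried_Suc: "1 \<le> t \<Longrightarrow> carried (Suc t) / M (Suc t) = st_delta p t (st_S p t) / M t"
  using W_Suc M_pos[of "Suc t"] by (simp add: carried_def)

lemma delta_pos:
  assumes "1 \<le> t" "s \<in> {1..st_S p t}" shows "0 < st_delta p t s"
proof -
  have "0 < st_delta p t 1" if "1 \<le> t" for t
    using that
  proof (induction t rule: dec_induct)
    case base
    have "1 \<in> {1..st_S p 1}" using S_ge_1[of 1] by simp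
    from delta_eq[OF _ this] show ?case
      using Gamma_pos[of 1] by (simp add: carried_def first_offset_def)
  next
    case (step t)
    have mono: "st_delta p t 1 \<le> st_delta p t (st_S p t)"
      using delta_eq[of t 1] delta_eq[of t "st_S p t"] S_ge_1[of t] Gamma_pos[of t] step
      by (simp add: divide_right_mono)
    have "1 \<in> {1..st_S p (Suc t)}" using S_ge_1[of "Suc t"] by simp
    from delta_eq[OF _ this] have "st_delta p (Suc t) 1 = carried (Suc t)"
      using step by (simp add: first_offset_def)
    moreover have "0 < carried (Suc t) / M (Suc t)"
      unfolding carried_Suc[OF step(1)] using mono step.IH M_pos[of t] by simp
    ultimately show ?case using M_pos[of "Suc t"] by (simp add: zero_less_divide_iff)
  qed
  moreover have "st_delta p t 1 \<le> st_delta p t s"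
    using delta_eq[of t 1] delta_eq[OF assms] assms S_ge_1[OF assms(1)] Gamma_pos[OF assms(1)]
    by (simp add: divide_right_mono)
  ultimately show ?thesis using assms by force
qed

lemma sum_delta:
  assumes "1 \<le> t" shows "(\<Sum>s = 1..st_S p t. st_delta p t s) = st_Gamma p t * target t"
proof -
  let ?G = "st_Gamma p t"
  have G: "0 < ?G" by (rule Gamma_pos[OF assms])
  have "?G * (\<Sum>s = 1..st_S p t. st_delta p t s)
      = (\<Sum>s = 1..st_S p t. ?G * carried t + (real s - 1 + first_offset t))"
    unfolding sum_distrib_left
  proof (rule sum.cong[OF refl])
    fix s assume "s \<in> {1..st_S p t}"
    from delta_eq[OF assms this] show "?G * st_delta p t s = ?G * carried t + (real s - 1 + first_offset t)"
      using G by (simp add: field_simps)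
  qed
  also have "\<dots> = ?G * (?G * target t)"
    unfolding Gamma_sum_eq[OF assms] by (simp add: power2_eq_square)
  finally show ?thesis using G by simp
qed

section \<open>Weights of the inner iterations\<close>

abbreviation "w \<equiv> sc_weight p"

text \<open>The common value of all products \<open>w \<gamma>\<close> (\<open>weight_gamma\<close>). Its constancy across iterations and
  phases is what makes the distances between multipliers telescope exactly.\<close>

definition "dual_const = 4 / (\<alpha> * \<Delta>)"

lemma dual_const_pos: "0 < dual_const" using alpha_pos Delta_pos by (simp add: dual_const_def)

lemma weight_eq:
  assumes "1 \<le> t"
  shows "w t s = st_delta p t s / (st_Gamma p t * (M t)\<^sup>2 * \<Delta>)"
  using omega_pos[OF assms] unfolding sc_weight_def sum_delta[OF assms] target_def
  by (simp add: field_simps)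

lemma weight_pos:
  assumes "1 \<le> t" "s \<in> {1..st_S p t}" shows "0 < w t s"
  unfolding weight_eq[OF assms(1)]
  using delta_pos[OF assms] Gamma_pos[OF assms(1)] M_pos[of t] Delta_pos by simp

lemma sum_weight:
  assumes "1 \<le> t" shows "(\<Sum>s = 1..st_S p t. w t s) = st_omega p t"
proof -
  have "(\<Sum>s = 1..st_S p t. st_delta p t s) \<noteq> 0"
    unfolding sum_delta[OF assms] using Gamma_pos[OF assms] target_pos[OF assms] by simp
  then show ?thesis
    by (simp add: sc_weight_def flip: sum_distrib_left sum_divide_distrib)
qed

lemma weight_gamma:
  assumes "1 \<le> t" "s \<in> {1..st_S p t}" shows "w t s * st_gamma p t s = dual_const"
  unfolding weight_eq[OF assms(1)] gamma_eq[OF assms] dual_const_def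
  using delta_pos[OF assms] Gamma_pos[OF assms(1)] M_pos[of t] Delta_pos alpha_pos
  by (simp add: field_simps power2_eq_square)

text \<open>Factored out, this turns the weighted \<open>\<beta>\<close> into a product of two consecutive \<open>\<delta>\<close>.\<close>

definition "prox_unit t = \<alpha> / (4 * (M t)\<^sup>2 * \<Delta>)"

lemma prox_unit_pos: "0 < prox_unit t" using alpha_pos Delta_pos M_pos[of t] by (simp add: prox_unit_def)

lemma weight_beta:
  assumes "1 \<le> t" "s \<in> {1..st_S p t}"
  shows "w t s * st_beta p t s = prox_unit t * (st_delta p t s * prev_delta t s)"
  unfolding weight_eq[OF assms(1)] beta_prev[OF assms] prox_unit_def
  using Gamma_pos[OF assms(1)] M_pos[of t] Delta_pos by (simp add: field_simps)

lemma weight_beta_alpha: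
  assumes "1 \<le> t" "s \<in> {1..st_S p t}"
  shows "w t s * (st_beta p t s + \<alpha> / 2)
    = prox_unit t * (st_delta p t s * (prev_delta t s + 2 / st_Gamma p t))"
proof -
  have "w t s * (\<alpha> / 2) = prox_unit t * (st_delta p t s * (2 / st_Gamma p t))"
    unfolding weight_eq[OF assms(1)] prox_unit_def
    using Gamma_pos[OF assms(1)] M_pos[of t] Delta_pos by (simp add: field_simps)
  then show ?thesis using weight_beta[OF assms] by (simp add: distrib_left)
qed

text \<open>The carried weight is defined such that \<open>W\<^sub>t\<^sub>+\<^sub>1\<close> is the last \<open>\<delta>\<close> of phase \<open>t\<close> divided by \<open>M\<^sub>t\<close>: in
  the product \<open>w \<beta>\<close> at the start of the next phase its own norm \<open>M\<^sub>t\<^sub>+\<^sub>1\<close> cancels, so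
  phases with different Jacobians fit together.\<close>

lemma weight_beta_cross:
  assumes "1 \<le> t"
  shows "w (Suc t) 1 * st_beta p (Suc t) 1 = prox_unit t * (st_delta p t (st_S p t))\<^sup>2"
proof -
  have 1: "1 \<in> {1..st_S p (Suc t)}" using S_ge_1[of "Suc t"] by simp
  have "st_delta p (Suc t) 1 = carried (Suc t)" "prev_delta (Suc t) 1 = carried (Suc t)"
    using delta_eq[OF _ 1] assms by (simp_all add: first_offset_def prev_delta_def)
  then have "w (Suc t) 1 * st_beta p (Suc t) 1 = \<alpha> / (4 * \<Delta>) * (carried (Suc t) / M (Suc t))\<^sup>2"
    using weight_beta[OF _ 1] by (simp add: prox_unit_def power2_eq_square)
  then show ?thesis unfolding carried_Suc[OF assms] by (simp add: prox_unit_def power2_eq_square)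
qed

lemma weight_beta_first: "w 1 1 * st_beta p 1 1 = 0"
proof -
  have 1: "1 \<in> {1..st_S p 1}" using S_ge_1[of 1] by simp
  show ?thesis using weight_beta[OF _ 1] by (simp add: prev_delta_def carried_def)
qed

lemma delta_power2_le:
  assumes "1 \<le> t" "s \<in> {1..st_S p t}"
  shows "st_delta p t s * (st_delta p t s + 1 / st_Gamma p t)
    \<le> st_delta p t s * (prev_delta t s + 2 / st_Gamma p t)"
  using delta_le_prev[OF assms] delta_pos[OF assms] by (intro mult_left_mono) auto

text \<open>The \<open>\<delta>\<close> increase by at most \<open>1 / \<Gamma>\<close> per iteration, hence by at most \<open>2 / \<Gamma>\<close> over two, and the term
  \<open>\<alpha> / 2\<close> on the right contributes exactly \<open>2 / \<Gamma>\<close>.\<close>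

lemma weight_beta_step:
  assumes "1 \<le> t" "s \<in> {1..<st_S p t}"
  shows "w t (Suc s) * st_beta p t (Suc s) \<le> w t s * (st_beta p t s + \<alpha> / 2)"
proof -
  have s: "s \<in> {1..st_S p t}" "Suc s \<in> {1..st_S p t}" using assms by auto
  have "st_delta p t (Suc s) \<le> st_delta p t s + 1 / st_Gamma p t"
    using delta_le_prev[OF assms(1) s(2)] prev_delta_Suc s by simp
  then have "st_delta p t s * st_delta p t (Suc s) \<le> st_delta p t s * (st_delta p t s + 1 / st_Gamma p t)"
    using delta_pos[OF assms(1) s(1)] by (intro mult_left_mono) auto
  also note delta_power2_le[OF assms(1) s(1)]
  finally have "prox_unit t * (st_delta p t s * st_delta p t (Suc s))
      \<le> prox_unit t * (st_delta p t s * (prev_delta t s + 2 / st_Gamma p t))"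
    by (rule mult_left_mono) (simp add: less_imp_le prox_unit_pos)
  then show ?thesis
    unfolding weight_beta[OF assms(1) s(2)] weight_beta_alpha[OF assms(1) s(1)]
    using prev_delta_Suc[of s t] s by (simp add: mult.commute)
qed

lemma weight_beta_phase:
  assumes "1 \<le> t"
  shows "w (Suc t) 1 * st_beta p (Suc t) 1
    \<le> w t (st_S p t) * (st_beta p t (st_S p t) + \<alpha> / 2)"
proof -
  have S: "st_S p t \<in> {1..st_S p t}" using S_ge_1[OF assms] by simp
  have "st_delta p t (st_S p t) * st_delta p t (st_S p t)
      \<le> st_delta p t (st_S p t) * (st_delta p t (st_S p t) + 1 / st_Gamma p t)"
    using delta_pos[OF assms S] Gamma_pos[OF assms] by (intro mult_left_mono) auto
  also note delta_power2_le[OF assms S]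
  finally show ?thesis
    unfolding weight_beta_cross[OF assms] weight_beta_alpha[OF assms S] power2_eq_square
    by (rule mult_left_mono) (simp add: less_imp_le prox_unit_pos)
qed

text \<open>The condition under which the primal and dual proximal terms dominate the coupling through the
  Jacobian, in the form required by \<open>coupled_product_le\<close>. It is here that \<open>\<Gamma> \<ge> 1\<close> matters.\<close>

lemma weight_coupling_self:
  assumes "1 \<le> t" "s \<in> {1..st_S p t}"
  shows "(w t s * M t)\<^sup>2 \<le> prox_unit t * (st_delta p t s)\<^sup>2 * dual_const"
proof -
  have "(w t s * M t)\<^sup>2 = (st_delta p t s / (M t * \<Delta>))\<^sup>2 / (st_Gamma p t)\<^sup>2"
    unfolding weight_eq[OF assms(1)]
    using Gamma_pos[OF assms(1)] M_pos[of t] Delta_pos by (simp add: field_simps power2_eq_square)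
  also have "\<dots> \<le> (st_delta p t s / (M t * \<Delta>))\<^sup>2 / 1"
    using Gamma_ge_1[OF assms(1)] by (intro divide_left_mono) (auto intro: one_le_power)
  also have "(st_delta p t s / (M t * \<Delta>))\<^sup>2 / 1 = prox_unit t * (st_delta p t s)\<^sup>2 * dual_const"
    using M_pos[of t] Delta_pos alpha_pos by (simp add: prox_unit_def dual_const_def field_simps power2_eq_square)
  finally show ?thesis .
qed

lemma weight_coupling:
  assumes "1 \<le> t" "s \<in> {1..<st_S p t}"
  shows "(w t s * M t)\<^sup>2 \<le> w t (Suc s) * st_beta p t (Suc s) * dual_const"
proof -
  have s: "s \<in> {1..st_S p t}" "Suc s \<in> {1..st_S p t}" using assms by auto
  have p: "prev_delta t (Suc s) = st_delta p t s" using prev_delta_Suc s by simp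
  have "(st_delta p t s)\<^sup>2 \<le> st_delta p t (Suc s) * prev_delta t (Suc s)"
    using prev_delta_le[OF assms(1) s(2)] delta_pos[OF assms(1) s(1)]
    unfolding p power2_eq_square by (intro mult_right_mono) auto
  then have "prox_unit t * (st_delta p t s)\<^sup>2 * dual_const
      \<le> prox_unit t * (st_delta p t (Suc s) * prev_delta t (Suc s)) * dual_const"
    using prox_unit_pos[of t] dual_const_pos by (intro mult_right_mono mult_left_mono) auto
  then show ?thesis
    using weight_coupling_self[OF assms(1) s(1)] weight_beta[OF assms(1) s(2)] by simp
qed

lemma weight_coupling_phase:
  assumes "1 \<le> t"
  shows "(w t (st_S p t) * M t)\<^sup>2 \<le> w (Suc t) 1 * st_beta p (Suc t) 1 * dual_const"
  using weight_coupling_self[OF assms, of "st_S p t"] S_ge_1[OF assms]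
  unfolding weight_beta_cross[OF assms] by simp

lemma rho_weight:
  assumes "1 \<le> t" "s \<in> {2..st_S p t}" shows "w t s * st_rho p t s = w t (s - 1)"
proof -
  have "st_rho p t s = st_delta p t (s - 1) / st_delta p t s"
    using extrapolation assms by (simp add: sc_extrapolation_def)
  then show ?thesis using delta_pos[OF assms(1), of s] assms
    by (simp add: sc_weight_def)
qed

lemma rho_weight_phase:
  assumes "1 \<le> t" shows "w (Suc t) 1 * st_rho p (Suc t) 1 = w t (st_S p t)"
proof -
  have "st_rho p (Suc t) 1 = w t (st_S p t) / w (Suc t) 1"
    using extrapolation assms by (simp add: sc_extrapolation_def)
  then show ?thesis using weight_pos[of "Suc t" 1] S_ge_1[of "Suc t"] by simp
qed

section \<open>Number of inner iterations\<close>

text \<open>Multiplied by \<open>\<Gamma>\<^sup>2\<close>, the increase of the squared \<open>\<delta>\<close> over the phase is at most twice the left-hand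
  side of the equation for \<open>\<Gamma>\<close>, hence at most \<open>2 \<Gamma>\<^sup>2\<close> times the target.\<close>

lemma W_growth:
  assumes "1 \<le> t"
  shows "(st_W p (Suc t))\<^sup>2 \<le> (carried t / M t)\<^sup>2 + 2 * \<Delta> * st_omega p t"
proof -
  define S where "S = real (st_S p t)"
  define e where "e = first_offset t"
  define a where "a = carried t"
  define G where "G = st_Gamma p t"
  have S: "1 \<le> S" using S_ge_1[OF assms] by (simp add: S_def)
  have e: "e = 0 \<or> e = 1" by (simp add: e_def first_offset_def)
  have a: "0 \<le> a" using carried_nonneg[OF assms] by (simp add: a_def)
  have e': "e \<noteq> 0 \<Longrightarrow> a = 0" by (auto simp: e_def a_def carried_def first_offset_def)
  have G: "0 < G" using Gamma_pos[OF assms] by (simp add: G_def)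
  have d: "st_delta p t (st_S p t) = a + (S - 1 + e) / G"
    using delta_eq[OF assms, of "st_S p t"] S_ge_1[OF assms] by (simp add: a_def e_def S_def G_def)
  have "G\<^sup>2 * (st_delta p t (st_S p t))\<^sup>2 = (G * a + (S - 1 + e))\<^sup>2"
    unfolding d using G by (simp add: field_simps power2_eq_square)
  also have "\<dots> = G\<^sup>2 * a\<^sup>2 + (2 * (S - 1 + e) * (G * a) + (S - 1 + e)\<^sup>2)"
    by (simp add: power2_eq_square algebra_simps)
  also have "\<dots> \<le> G\<^sup>2 * a\<^sup>2 + (2 * S * (G * a) + 2 * (S * (S - 1) / 2 + e * S))"
  proof (intro add_left_mono add_mono)
    show "2 * (S - 1 + e) * (G * a) \<le> 2 * S * (G * a)"
      using e a G by (intro mult_right_mono) auto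
    show "(S - 1 + e)\<^sup>2 \<le> 2 * (S * (S - 1) / 2 + e * S)"
    proof -
      have "2 * (S * (S - 1) / 2 + e * S) = S * S - S + 2 * (e * S)" by (simp add: field_simps)
      then show ?thesis using e S by (auto simp: power2_eq_square algebra_simps)
    qed
  qed
  also have "\<dots> = G\<^sup>2 * a\<^sup>2 + 2 * (G\<^sup>2 * target t)"
  proof -
    have "G * (S * a) + (S * (S - 1) / 2 + e * S) = G\<^sup>2 * target t"
      using Gamma_eq[OF assms] by (simp only: S_def e_def G_def a_def)
    moreover have "2 * S * (G * a) + 2 * T = 2 * (G * (S * a) + T)" for T by (simp add: algebra_simps)
    ultimately show ?thesis by (simp only:)
  qed
  finally have "G\<^sup>2 * (st_delta p t (st_S p t))\<^sup>2 \<le> G\<^sup>2 * (a\<^sup>2 + 2 * target t)"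
    by (simp add: algebra_simps)
  then have "(st_delta p t (st_S p t))\<^sup>2 \<le> a\<^sup>2 + 2 * target t" using G by simp
  then have "(st_delta p t (st_S p t))\<^sup>2 / (M t)\<^sup>2 \<le> (a\<^sup>2 + 2 * target t) / (M t)\<^sup>2"
    by (rule divide_right_mono) simp
  then show ?thesis unfolding W_Suc[OF assms] using M_pos[of t]
    by (simp add: power_divide a_def target_def add_divide_distrib mult_ac)
qed

lemma W_nonneg: "1 \<le> t \<Longrightarrow> 0 \<le> st_W p (Suc t)"
  using W_Suc delta_pos[of t "st_S p t"] S_ge_1[of t] M_pos[of t] by simp

lemma W_power2_le: "1 \<le> N \<Longrightarrow> (st_W p (Suc N))\<^sup>2 \<le> 2 * \<Delta> * (\<Sum>t = 1..N. st_omega p t)"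
proof (induction N rule: dec_induct)
  case base
  then show ?case using W_growth[of 1] by (simp add: carried_def)
next
  case (step N)
  have "carried (Suc N) / M (Suc N) = st_W p (Suc N)"
    using step M_pos[of "Suc N"] by (simp add: carried_def)
  then show ?case using W_growth[of "Suc N"] step.IH by (simp add: algebra_simps)
qed

text \<open>Each inner iteration raises \<open>\<delta>\<close> by \<open>1 / \<Gamma>\<close>, and \<open>\<Gamma> \<le> 3\<close> for phases of at least three iterations. The
  constant 2 accounts for shorter phases.\<close>

lemma S_le:
  assumes "1 \<le> t"
  shows "real (st_S p t) \<le> 2 + 3 * M t * (st_W p (Suc t) - carried t / M t)"
proof -
  define S where "S = real (st_S p t)"
  define Q where "Q = (S - 1 + first_offset t) / st_Gamma p t"
  have "M t * (st_W p (Suc t) - carried t / M t) = Q"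
    using delta_eq[OF assms, of "st_S p t"] S_ge_1[OF assms] M_pos[of t]
    by (simp add: W_Suc[OF assms] right_diff_distrib S_def Q_def)
  then have Q: "3 * M t * (st_W p (Suc t) - carried t / M t) = 3 * Q"
    by (simp only: mult.assoc)
  have G: "0 < st_Gamma p t" using Gamma_pos[OF assms] .
  show ?thesis
  proof (cases "3 \<le> st_S p t")
    case True
    have "(S - 1) / 3 \<le> (S - 1) / st_Gamma p t"
      using True G Gamma_le_3[OF assms True] by (intro divide_left_mono) (auto simp: S_def)
    also have "\<dots> \<le> Q"
      unfolding Q_def using G offset_nonneg[of t] by (intro divide_right_mono) auto
    finally show ?thesis unfolding Q S_def by simp
  next
    case False
    have "0 \<le> Q"
      using G offset_nonneg[of t] S_ge_1[OF assms] by (simp add: S_def Q_def)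
    then show ?thesis unfolding Q using False by simp
  qed
qed

lemma carried_le_W:
  assumes "1 \<le> t" shows "carried t / M t \<le> st_W p (Suc t)"
proof -
  have S: "1 \<le> st_S p t" by (rule S_ge_1[OF assms])
  have "carried t \<le> st_delta p t (st_S p t)"
    using delta_eq[OF assms, of "st_S p t"] S Gamma_pos[OF assms] offset_nonneg[of t] by simp
  then show ?thesis unfolding W_Suc[OF assms] using M_pos[of t] by (simp add: divide_right_mono)
qed

lemma sum_S_le:
  assumes M: "\<And>t. 1 \<le> t \<Longrightarrow> M t \<le> K" and "1 \<le> N"
  shows "(\<Sum>t = 1..N. real (st_S p t)) \<le> 2 * real N + 3 * K * st_W p (Suc N)"
  using \<open>1 \<le> N\<close>
proof (induction N rule: dec_induct)
  case base
  have "M 1 * st_W p (Suc 1) \<le> K * st_W p (Suc 1)"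
    using M[of 1] W_nonneg[of 1] by (intro mult_right_mono) auto
  then show ?case using S_le[of 1] by (simp add: carried_def)
next
  case (step N)
  have c: "carried (Suc N) / M (Suc N) = st_W p (Suc N)"
    using step M_pos[of "Suc N"] by (simp add: carried_def)
  have "M (Suc N) * (st_W p (Suc (Suc N)) - st_W p (Suc N)) \<le> K * (st_W p (Suc (Suc N)) - st_W p (Suc N))"
    using M[of "Suc N"] carried_le_W[of "Suc N"] unfolding c by (intro mult_right_mono) auto
  then show ?case using S_le[of "Suc N"] step.IH unfolding c by (simp add: algebra_simps)
qed

end

section \<open>The method: setting and linearisations\<close>

locale acgd_s =
  fixes X :: "(real^'n) set"
    and f u :: "real^'n \<Rightarrow> real"
    and g :: "real^'n \<Rightarrow> real^'m"
    and \<alpha> c R L :: real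
    and xs x0 :: "real^'n"
    and ls :: "real^'m"
    and Lip :: "real^'m \<Rightarrow> real"
    and p :: steps
    and r :: "('n, 'm) iterates"
  assumes cvx_X: "convex X"
    and cvx_f: "convex_on UNIV f" and diff_f: "\<And>x. f differentiable (at x)"
    and cvx_g: "\<And>i. convex_on UNIV (\<lambda>x. g x $ i)" and diff_g: "\<And>x. g differentiable (at x)"
    and cvx_u: "strongly_convex_on X \<alpha> u"
    and alpha: "\<alpha> > 0" and c: "c \<ge> 1" and R: "R > 0"
    and kkt: "kkt_pair X f g u xs ls"
    and Lip: "\<And>l. l \<in> nonneg_orthant \<Longrightarrow> (Lip l)-lipschitz_on UNIV (grad (\<lambda>x. f x + l \<bullet> g x))"
    and Lip_bdd: "bdd_above (Lip ` multiplier_set ls c)" and Lip_0: "Lip 0 \<ge> \<alpha>"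
    and L: "L = (SUP l\<in>multiplier_set ls c. Lip l)"
    and run: "acgd_s_run X f g u x0 p r"
    and rule: "sc_rule \<alpha> L R r p"
begin

text \<open>The smoothness constant is available for the multipliers in \<open>\<Lambda>\<^sub>c\<close> only; this is why the outer
  estimates below are restricted to them.\<close>

lemma Lip_le_L: "l \<in> multiplier_set ls c \<Longrightarrow> Lip l \<le> L"
  unfolding L by (rule cSUP_upper[OF _ Lip_bdd])

sublocale sc_steps \<alpha> L R "nu_size r" p
proof
  show "\<alpha> \<le> L" using Lip_le_L[of 0] Lip_0 by (simp add: multiplier_set_def)
  show "0 < nu_size r t" for t by (simp add: nu_size_def)
qed (use alpha R rule in \<open>auto simp: sc_rule_def\<close>)

abbreviation "x \<equiv> it_x r"
abbreviation "xu \<equiv> it_xu r"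
abbreviation "y \<equiv> it_y r"
abbreviation "lam \<equiv> it_lam r"
abbreviation "nu \<equiv> it_nu r"

definition "lin_f t v = f (xu t) + it_pi r t \<bullet> (v - xu t)"

definition "lin_g t v = nu t *v (v - xu t) + g (xu t)"

definition "F_min = f xs + u xs"

lemma init: "acgd_init X f g x0 r"
  and outer_step: "1 \<le> t \<Longrightarrow> acgd_outer_step f g p r t"
  and inner_step: "1 \<le> t \<Longrightarrow> s \<in> {1..st_S p t} \<Longrightarrow> acgd_inner_step X g u p r t s"
  and phase_end: "1 \<le> t \<Longrightarrow> acgd_phase_end p r t"
  using run by (auto simp: acgd_s_run_def)

lemma pi_eq: "it_pi r t = grad f (xu t)" and nu_eq: "nu t = jac g (xu t)"
  using init outer_step[of t] by (cases t; simp add: acgd_init_def acgd_outer_step_def)+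

lemma xs_X: "xs \<in> X" and g_xs: "g xs $ i \<le> 0" and ls_nonneg: "ls \<in> nonneg_orthant"
  using kkt by (auto simp: kkt_pair_def optimal_solution_def)

lemma GDERIV_f: "GDERIV f z :> grad f z"
  by (rule GDERIV_grad[OF diff_f])

lemma GDERIV_g: "GDERIV (\<lambda>z. g z $ i) z :> jac g z $ i"
proof -
  have "(g has_derivative (\<lambda>h. jac g z *v h)) (at z)" using diff_g jacobian_works by blast
  then have "((\<lambda>z. g z $ i) has_derivative (\<lambda>h. (jac g z *v h) $ i)) (at z)"
    by (rule bounded_linear.has_derivative[OF bounded_linear_vec_nth])
  then show ?thesis by (simp add: gderiv_def matrix_vector_mul_component inner_commute)
qed

lemma GDERIV_lagrangian:
  "GDERIV (\<lambda>z. f z + l \<bullet> g z) z :> grad f z + transpose (jac g z) *v l"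
proof -
  have "(g has_derivative (\<lambda>h. jac g z *v h)) (at z)" using diff_g jacobian_works by blast
  then have "((\<lambda>z. l \<bullet> g z) has_derivative (\<lambda>h. l \<bullet> (jac g z *v h))) (at z)"
    by (rule has_derivative_inner_right)
  then have "GDERIV (\<lambda>z. l \<bullet> g z) z :> transpose (jac g z) *v l"
    unfolding gderiv_def using inner_transpose[of "jac g z" l] by (simp only: inner_commute)
  then show ?thesis by (rule GDERIV_add[OF GDERIV_f])
qed

lemma lin_f_le: "lin_f t v \<le> f v"
  unfolding lin_f_def pi_eq by (rule convex_on_above_gradient[OF cvx_f GDERIV_f])

lemma lin_g_le: "lin_g t v $ i \<le> g v $ i"
  using convex_on_above_gradient[OF cvx_g[of i] GDERIV_g[of i "xu t"], of v]
  by (simp add: lin_g_def nu_eq matrix_vector_mul_component add.commute)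

lemma lin_g_diff: "lin_g t v - lin_g t z = nu t *v (v - z)"
  by (simp add: lin_g_def algebra_simps)

lemma y_in_X: "1 \<le> t \<Longrightarrow> s \<in> {1..st_S p t} \<Longrightarrow> y t s \<in> X"
  and lam_nonneg: "1 \<le> t \<Longrightarrow> s \<in> {1..st_S p t} \<Longrightarrow> lam t s \<in> nonneg_orthant"
  using inner_step[of t s] by (auto simp: acgd_inner_step_def is_arg_min_def is_arg_max_def)

lemma convex_nonneg_orthant: "convex (nonneg_orthant :: (real^'m) set)"
  by (auto simp: convex_def nonneg_orthant_def)

section \<open>Potential of the inner iterations\<close>

lemma primal_step:
  assumes "1 \<le> t" "s \<in> {1..st_S p t}"
  shows "(it_h r t s + it_pi r t) \<bullet> (y t s - xs) + u (y t s) - u xs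
      + st_eta p t / 2 * (norm (y t s - x (t - 1)))\<^sup>2 + st_beta p t s / 2 * (norm (y t s - y t (s - 1)))\<^sup>2
      + (\<alpha> + st_eta p t + st_beta p t s) / 2 * (norm (xs - y t s))\<^sup>2
    \<le> st_eta p t / 2 * (norm (xs - x (t - 1)))\<^sup>2 + st_beta p t s / 2 * (norm (xs - y t (s - 1)))\<^sup>2"
proof -
  define q where "q = it_h r t s + it_pi r t"
  define J where "J = (\<lambda>v. q \<bullet> v + u v + st_eta p t / 2 * (norm (v - x (t - 1)))\<^sup>2
      + st_beta p t s / 2 * (norm (v - y t (s - 1)))\<^sup>2)"
  have "strongly_convex_on X (0 + \<alpha> + st_eta p t + st_beta p t s) J"
    unfolding J_def using cvx_X cvx_u
    by (intro strongly_convex_on_add strongly_convex_on_quadratic strongly_convex_on_inner)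
  moreover have "is_arg_min J (\<lambda>v. v \<in> X) (y t s)"
    using inner_step[OF assms] unfolding acgd_inner_step_def J_def q_def by blast
  ultimately have "J (y t s) + (0 + \<alpha> + st_eta p t + st_beta p t s) / 2 * (norm (xs - y t s))\<^sup>2 \<le> J xs"
    by (rule strongly_convex_argmin_growth) (rule xs_X)
  then show ?thesis unfolding q_def[symmetric] J_def by (simp add: inner_diff_right)
qed

lemma dual_step:
  assumes "1 \<le> t" "s \<in> {1..st_S p t}" "l \<in> nonneg_orthant"
  shows "(l - lam t s) \<bullet> lin_g t (y t s)
    \<le> st_gamma p t s / 2 * ((norm (l - lam t (s - 1)))\<^sup>2 - (norm (l - lam t s))\<^sup>2
        - (norm (lam t s - lam t (s - 1)))\<^sup>2)"
proof -
  define J where "J = (\<lambda>v. (- lin_g t (y t s)) \<bullet> v + st_gamma p t s / 2 * (norm (v - lam t (s - 1)))\<^sup>2)"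
  have "strongly_convex_on nonneg_orthant (0 + st_gamma p t s) J"
    unfolding J_def by (intro strongly_convex_on_add strongly_convex_on_quadratic
        strongly_convex_on_inner convex_nonneg_orthant)
  moreover have "is_arg_min J (\<lambda>v. v \<in> nonneg_orthant) (lam t s)"
    using inner_step[OF assms(1,2)]
    by (simp add: acgd_inner_step_def is_arg_max_def is_arg_min_def J_def lin_g_def inner_commute
        not_less algebra_simps)
  ultimately have "J (lam t s) + (0 + st_gamma p t s) / 2 * (norm (l - lam t s))\<^sup>2 \<le> J l"
    by (rule strongly_convex_argmin_growth) (rule assms(3))
  then show ?thesis unfolding J_def
    by (simp add: inner_diff_left inner_commute[of "lin_g t (y t s)"] field_simps)
qed

text \<open>The Lagrangian gap with \<open>f\<close> and \<open>g\<close> linearised at the oracle point of phase \<open>t\<close>, plus the proximal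
  terms that the outer loop consumes. The coefficient \<open>\<eta>\<^sub>t + \<alpha> / 2\<close> reserves half of the strong
  convexity for the outer loop.\<close>

definition "phase_gap t v l = lin_f t v + u v + l \<bullet> lin_g t v + st_eta p t / 2 * (norm (v - x (t - 1)))\<^sup>2
   + (st_eta p t + \<alpha> / 2) / 2 * (norm (xs - v))\<^sup>2 - st_eta p t / 2 * (norm (xs - x (t - 1)))\<^sup>2 - F_min"

text \<open>The three-point inequalities of both proximal steps, added. The linearised constraints are
  nonpositive at \<open>x\<^sup>*\<close> because \<open>g\<close> is convex and \<open>x\<^sup>*\<close> feasible, so the new multiplier may be
  paired with them for free.\<close>

lemma inner_gap:
  assumes t: "1 \<le> t" and s: "s \<in> {1..st_S p t}" and l: "l \<in> nonneg_orthant"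
  shows "phase_gap t (y t s) l
    \<le> (transpose (nu t) *v lam t s - it_h r t s) \<bullet> (y t s - xs)
      + st_beta p t s / 2 * ((norm (xs - y t (s - 1)))\<^sup>2 - (norm (y t s - y t (s - 1)))\<^sup>2)
      - (st_beta p t s + \<alpha> / 2) / 2 * (norm (xs - y t s))\<^sup>2
      + st_gamma p t s / 2 * ((norm (l - lam t (s - 1)))\<^sup>2 - (norm (l - lam t s))\<^sup>2
        - (norm (lam t s - lam t (s - 1)))\<^sup>2)"
proof -
  have 1: "(it_h r t s + it_pi r t) \<bullet> (y t s - xs) = it_h r t s \<bullet> (y t s - xs) + (lin_f t (y t s) - lin_f t xs)"
    by (simp add: lin_f_def inner_diff_right inner_add_left)
  have 2: "(transpose (nu t) *v lam t s) \<bullet> (y t s - xs) = lam t s \<bullet> lin_g t (y t s) - lam t s \<bullet> lin_g t xs"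
    unfolding inner_transpose lin_g_diff[symmetric] by (rule inner_diff_right)
  have 3: "lin_f t xs \<le> f xs" by (rule lin_f_le)
  have "lam t s \<bullet> lin_g t xs \<le> lam t s \<bullet> 0"
    using lin_g_le[of t xs] g_xs order_trans
    by (intro inner_nonneg_orthant_mono lam_nonneg[OF t s]) (simp, blast)
  then have 4: "lam t s \<bullet> lin_g t xs \<le> 0" by simp
  have 5: "(st_beta p t s + \<alpha> / 2) / 2 * N = (\<alpha> + st_eta p t + st_beta p t s) / 2 * N
      - (st_eta p t + \<alpha> / 2) / 2 * N" for N by (simp add: field_simps)
  have 6: "st_beta p t s / 2 * (P - Q) = st_beta p t s / 2 * P - st_beta p t s / 2 * Q" for P Q
    by (rule right_diff_distrib)
  have 7: "(l - lam t s) \<bullet> lin_g t (y t s) = l \<bullet> lin_g t (y t s) - lam t s \<bullet> lin_g t (y t s)"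
    "(transpose (nu t) *v lam t s - it_h r t s) \<bullet> (y t s - xs)
      = (transpose (nu t) *v lam t s) \<bullet> (y t s - xs) - it_h r t s \<bullet> (y t s - xs)"
    by (rule inner_diff_left)+
  show ?thesis
    using primal_step[OF t s] dual_step[OF t s l] 3 4
    unfolding phase_gap_def F_min_def 1 5 6 7 2 by linarith
qed

text \<open>The last change of the multiplier before the iteration \<open>s + 1\<close> of phase \<open>t\<close>; for \<open>s = 0\<close> it took
  place in the previous phase.\<close>

definition "dual_change t s = (if s = 0 then lam t 0 - it_lamm r t else lam t s - lam t (s - 1))"

text \<open>The last dual change, mapped to the primal space by the Jacobian that was in force when it happened
  and weighted accordingly. At \<open>s = 0\<close> this is the Jacobian of the previous phase, and 0 if there
  is none.\<close>

definition "momentum t s =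
  (if 1 \<le> s then w t s *\<^sub>R (transpose (nu t) *v dual_change t s)
   else if t = 1 then 0
   else w (t - 1) (st_S p (t - 1)) *\<^sub>R (transpose (nu (t - 1)) *v dual_change t 0))"

text \<open>The direction \<open>h\<close> extrapolates the dual variable by the factor \<open>\<rho>\<close>, a quotient of consecutive
  weights. After multiplication by the weight, the extrapolation error is a difference of consecutive
  momenta and therefore telescopes.\<close>

lemma momentum_diff:
  assumes t: "1 \<le> t" and s: "s \<in> {1..st_S p t}"
  shows "w t s *\<^sub>R (transpose (nu t) *v lam t s - it_h r t s) = momentum t s - momentum t (s - 1)"
proof -
  have m: "momentum t s = w t s *\<^sub>R (transpose (nu t) *v lam t s) - w t s *\<^sub>R (transpose (nu t) *v lam t (s - 1))"
    using s by (simp add: momentum_def dual_change_def transpose_mult_diff scaleR_diff_right del: transpose_matrix_vector)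
  have "w t s *\<^sub>R (it_h r t s) = w t s *\<^sub>R (transpose (nu t) *v lam t (s - 1)) + momentum t (s - 1)"
  proof (cases "s = 1")
    case False
    then have s2: "s \<in> {2..st_S p t}" using s by auto
    have "it_h r t s = transpose (nu t) *v lam t (s - 1)
        + st_rho p t s *\<^sub>R (transpose (nu t) *v dual_change t (s - 1))"
      using inner_step[OF t s] s2 by (auto simp: acgd_inner_step_def dual_change_def numeral_2_eq_2
          simp del: transpose_matrix_vector)
    moreover have "1 \<le> s - 1" using s2 by auto
    ultimately show ?thesis using rho_weight[OF t s2]
      by (simp add: momentum_def scaleR_add_right del: transpose_matrix_vector)
  next
    case True
    have h: "it_h r t 1 = transpose (nu t) *v lam t 0
        + st_rho p t 1 *\<^sub>R (transpose (nu (t - 1)) *v dual_change t 0)"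
      using inner_step[OF t s] True by (simp add: acgd_inner_step_def dual_change_def
          del: transpose_matrix_vector)
    show ?thesis
    proof (cases "t = 1")
      case True
      then have "dual_change t 0 = 0" using init by (simp add: dual_change_def acgd_init_def)
      then show ?thesis using h True \<open>s = 1\<close> by (simp add: momentum_def)
    next
      case False
      then have "w t 1 * st_rho p t 1 = w (t - 1) (st_S p (t - 1))"
        using rho_weight_phase[of "t - 1"] t by simp
      then show ?thesis using h False \<open>s = 1\<close>
        by (simp add: momentum_def scaleR_add_right del: transpose_matrix_vector)
    qed
  qed
  then show ?thesis by (simp add: m scaleR_diff_right algebra_simps del: transpose_matrix_vector)
qed

lemma transpose_inner_le:
  "\<bar>(transpose (nu t) *v l) \<bullet> v\<bar> \<le> nu_size r t * norm l * norm v"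
proof -
  have "\<bar>(transpose (nu t) *v l) \<bullet> v\<bar> \<le> norm l * norm (nu t *v v)"
    unfolding inner_transpose by (rule Cauchy_Schwarz_ineq2)
  also have "\<dots> \<le> norm l * (nu_size r t * norm v)"
  proof (rule mult_left_mono)
    have "norm (nu t *v v) \<le> opnorm (nu t) * norm v" by (rule norm_mult_le_opnorm)
    also have "\<dots> \<le> nu_size r t * norm v"
      by (intro mult_right_mono) (auto simp: nu_size_def)
    finally show "norm (nu t *v v) \<le> nu_size r t * norm v" .
  qed simp
  finally show ?thesis by (simp add: mult_ac)
qed

lemma momentum_bound_self:
  assumes t: "1 \<le> t" and s: "s \<in> {1..st_S p t}" and a: "(w t s * nu_size r t)\<^sup>2 \<le> a * dual_const"
  shows "\<bar>w t s *\<^sub>R (transpose (nu t) *v l) \<bullet> v\<bar> \<le> a / 2 * (norm v)\<^sup>2 + dual_const / 2 * (norm l)\<^sup>2"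
proof -
  have "\<bar>w t s *\<^sub>R (transpose (nu t) *v l) \<bullet> v\<bar> = w t s * \<bar>(transpose (nu t) *v l) \<bullet> v\<bar>"
    using weight_pos[OF t s] by (simp add: abs_mult)
  also have "\<dots> \<le> w t s * (nu_size r t * norm l * norm v)"
    using weight_pos[OF t s] transpose_inner_le by (intro mult_left_mono) auto
  also have "\<dots> = (w t s * nu_size r t) * norm l * norm v" by (simp add: mult_ac)
  also have "\<dots> \<le> a / 2 * (norm v)\<^sup>2 + dual_const / 2 * (norm l)\<^sup>2"
    by (rule coupled_product_le[OF dual_const_pos a])
  finally show ?thesis .
qed

lemma dual_change_phase: "1 \<le> t \<Longrightarrow> dual_change (Suc t) 0 = dual_change t (st_S p t)"
  using phase_end[of t] S_ge_1[of t] by (simp add: dual_change_def acgd_phase_end_def)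

lemma y_phase: "1 \<le> t \<Longrightarrow> y (Suc t) 0 = y t (st_S p t)"
  and lam_phase: "1 \<le> t \<Longrightarrow> lam (Suc t) 0 = lam t (st_S p t)"
  using phase_end[of t] by (simp_all add: acgd_phase_end_def)

lemma momentum_phase: "1 \<le> t \<Longrightarrow> momentum (Suc t) 0 = momentum t (st_S p t)"
  using S_ge_1[of t] dual_change_phase[of t] by (simp add: momentum_def)

text \<open>The part of the momentum that does not telescope, bounded by the two proximal terms. In the first
  iteration of all, both the momentum and the weighted \<open>\<beta>\<close> vanish.\<close>

lemma momentum_bound:
  assumes t: "1 \<le> t" and s: "s \<in> {1..st_S p t}"
  shows "- (momentum t (s - 1) \<bullet> v)
    \<le> w t s * st_beta p t s / 2 * (norm v)\<^sup>2 + dual_const / 2 * (norm (dual_change t (s - 1)))\<^sup>2"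
proof (cases "s = 1")
  case False
  then have s': "s - 1 \<in> {1..<st_S p t}" "s - 1 \<in> {1..st_S p t}" "Suc (s - 1) = s" using s by auto
  have "(w t (s - 1) * nu_size r t)\<^sup>2 \<le> w t s * st_beta p t s * dual_const"
    using weight_coupling[OF t s'(1)] unfolding s'(3) .
  from momentum_bound_self[OF t s'(2) this, of "dual_change t (s - 1)" v]
  show ?thesis using s' by (simp add: momentum_def del: transpose_matrix_vector)
next
  case s1: True
  show ?thesis
  proof (cases "t = 1")
    case True
    then have 0: "w t s * st_beta p t s = 0" using s1 weight_beta_first by simp
    show ?thesis unfolding 0 using s1 True dual_const_pos by (simp add: momentum_def)
  next
    case False
    then have t': "1 \<le> t - 1" "Suc (t - 1) = t" using t by auto
    have S: "st_S p (t - 1) \<in> {1..st_S p (t - 1)}" using S_ge_1[OF t'(1)] by simp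
    have "(w (t - 1) (st_S p (t - 1)) * nu_size r (t - 1))\<^sup>2 \<le> w t 1 * st_beta p t 1 * dual_const"
      using weight_coupling_phase[OF t'(1)] unfolding t'(2) .
    from momentum_bound_self[OF t'(1) S this, of "dual_change t 0" v]
    show ?thesis using s1 False by (simp add: momentum_def del: transpose_matrix_vector)
  qed
qed

text \<open>The coefficient \<open>a\<close> of the primal distance is kept as a parameter: iteration \<open>s + 1\<close> consumes the
  potential with its own weighted \<open>\<beta>\<close>, whereas iteration \<open>s\<close> delivers it with the larger
  coefficient \<open>w (\<beta> + \<alpha> / 2)\<close> gained from strong convexity.\<close>

definition "potential t s a l = a / 2 * (norm (xs - y t s))\<^sup>2 + dual_const / 2 * (norm (l - lam t s))\<^sup>2
   + dual_const / 2 * (norm (dual_change t s))\<^sup>2 - momentum t s \<bullet> (y t s - xs)"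

abbreviation "pre t s l \<equiv> potential t (s - 1) (w t s * st_beta p t s) l"

abbreviation "post t s l \<equiv> potential t s (w t s * (st_beta p t s + \<alpha> / 2)) l"

text \<open>Weighting \<open>inner_gap\<close> makes the dual distances telescope by \<open>weight_gamma\<close> and the extrapolation
  errors by \<open>momentum_diff\<close>; the remaining cross term is \<open>momentum_bound\<close>.\<close>

lemma inner_potential:
  assumes t: "1 \<le> t" and s: "s \<in> {1..st_S p t}" and l: "l \<in> nonneg_orthant"
  shows "w t s * phase_gap t (y t s) l + post t s l \<le> pre t s l"
proof -
  have w: "0 < w t s" by (rule weight_pos[OF t s])
  have dc: "lam t s - lam t (s - 1) = dual_change t s" using s by (simp add: dual_change_def)
  define A where "A = (transpose (nu t) *v lam t s - it_h r t s) \<bullet> (y t s - xs)"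
  define N1 where "N1 = (norm (xs - y t (s - 1)))\<^sup>2"
  define N2 where "N2 = (norm (y t s - y t (s - 1)))\<^sup>2"
  define N3 where "N3 = (norm (xs - y t s))\<^sup>2"
  define N4 where "N4 = (norm (l - lam t (s - 1)))\<^sup>2"
  define N5 where "N5 = (norm (l - lam t s))\<^sup>2"
  define N6 where "N6 = (norm (dual_change t s))\<^sup>2"
  have "w t s * phase_gap t (y t s) l \<le> w t s * (A + st_beta p t s / 2 * (N1 - N2)
      - (st_beta p t s + \<alpha> / 2) / 2 * N3 + st_gamma p t s / 2 * (N4 - N5 - N6))"
    using inner_gap[OF t s l] w unfolding dc A_def N1_def N2_def N3_def N4_def N5_def N6_def
    by (intro mult_left_mono) auto
  also have "\<dots> = w t s * A + w t s * st_beta p t s / 2 * (N1 - N2)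
      - w t s * (st_beta p t s + \<alpha> / 2) / 2 * N3 + (w t s * st_gamma p t s) / 2 * (N4 - N5 - N6)"
    by (simp add: algebra_simps)
  also have "w t s * st_gamma p t s = dual_const" by (rule weight_gamma[OF t s])
  also have "w t s * A = momentum t s \<bullet> (y t s - xs) - momentum t (s - 1) \<bullet> (y t (s - 1) - xs)
      - momentum t (s - 1) \<bullet> (y t s - y t (s - 1))"
  proof -
    have "w t s * A = (w t s *\<^sub>R (transpose (nu t) *v lam t s - it_h r t s)) \<bullet> (y t s - xs)"
      by (simp add: A_def del: transpose_matrix_vector)
    then show ?thesis unfolding momentum_diff[OF t s] by (simp add: inner_diff_left inner_diff_right)
  qed
  finally have 1: "w t s * phase_gap t (y t s) l
      \<le> momentum t s \<bullet> (y t s - xs) - momentum t (s - 1) \<bullet> (y t (s - 1) - xs)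
      - momentum t (s - 1) \<bullet> (y t s - y t (s - 1)) + w t s * st_beta p t s / 2 * (N1 - N2)
      - w t s * (st_beta p t s + \<alpha> / 2) / 2 * N3 + dual_const / 2 * (N4 - N5 - N6)" .
  have 2: "a / 2 * (P - Q) = a / 2 * P - a / 2 * Q" for a P Q :: real by (rule right_diff_distrib)
  have 3: "- (momentum t (s - 1) \<bullet> (y t s - y t (s - 1))) \<le> w t s * st_beta p t s / 2 * N2
      + dual_const / 2 * (norm (dual_change t (s - 1)))\<^sup>2"
    unfolding N2_def by (rule momentum_bound[OF t s])
  show ?thesis
    using 1 3 unfolding potential_def 2
      N1_def[symmetric] N3_def[symmetric] N4_def[symmetric] N5_def[symmetric] N6_def[symmetric]
    by linarith
qed

lemma potential_mono: "a \<le> b \<Longrightarrow> potential t s a l \<le> potential t s b l"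
  unfolding potential_def by (simp add: mult_right_mono)

lemma phase_potential:
  assumes t: "1 \<le> t" and l: "l \<in> nonneg_orthant"
  shows "(\<Sum>s = 1..st_S p t. w t s * phase_gap t (y t s) l) + post t (st_S p t) l \<le> pre t 1 l"
proof -
  have "1 \<le> k \<Longrightarrow> k \<le> st_S p t \<Longrightarrow>
      (\<Sum>s = 1..k. w t s * phase_gap t (y t s) l) + post t k l \<le> pre t 1 l" for k
  proof (induction k rule: dec_induct)
    case base
    then show ?case using inner_potential[OF t _ l, of 1] by simp
  next
    case (step k)
    have "pre t (Suc k) l \<le> post t k l"
      using weight_beta_step[OF t, of k] step by (simp add: potential_mono)
    then show ?case using inner_potential[OF t _ l, of "Suc k"] step by simp
  qed
  then show ?thesis using S_ge_1[OF t] by simp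
qed

text \<open>The last multipliers and the last primal point are handed over to the next phase, so only the
  coefficient of the primal distance changes.\<close>

lemma pre_phase: "1 \<le> t \<Longrightarrow> pre (Suc t) 1 l \<le> post t (st_S p t) l"
proof -
  assume t: "1 \<le> t"
  have "pre (Suc t) 1 l = potential t (st_S p t) (w (Suc t) 1 * st_beta p (Suc t) 1) l"
    using t by (simp add: potential_def dual_change_phase y_phase lam_phase momentum_phase)
  then show ?thesis using potential_mono[OF weight_beta_phase[OF t]] by simp
qed

text \<open>The coefficient delivered by the last iteration is large enough for a further iteration, so it also
  dominates the momentum that no iteration consumes any more.\<close>

lemma post_nonneg:
  assumes t: "1 \<le> t" shows "0 \<le> post t (st_S p t) l"
proof -
  have S: "st_S p t \<in> {1..st_S p t}" using S_ge_1[OF t] by simp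
  let ?a = "w t (st_S p t) * (st_beta p t (st_S p t) + \<alpha> / 2)"
  have "(w t (st_S p t) * nu_size r t)\<^sup>2 \<le> ?a * dual_const"
    using weight_coupling_phase[OF t] mult_right_mono[OF weight_beta_phase[OF t], of dual_const]
      dual_const_pos by linarith
  from momentum_bound_self[OF t S this, of "dual_change t (st_S p t)" "y t (st_S p t) - xs"]
  have "momentum t (st_S p t) \<bullet> (y t (st_S p t) - xs)
      \<le> ?a / 2 * (norm (xs - y t (st_S p t)))\<^sup>2 + dual_const / 2 * (norm (dual_change t (st_S p t)))\<^sup>2"
    using S by (simp add: momentum_def norm_minus_commute del: transpose_matrix_vector)
  moreover have "0 \<le> dual_const / 2 * (norm (l - lam t (st_S p t)))\<^sup>2"
    using dual_const_pos by simp
  ultimately show ?thesis unfolding potential_def by linarith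
qed

lemma pre_first: "pre 1 1 l = dual_const / 2 * (norm l)\<^sup>2"
  using init weight_beta_first
  by (simp add: potential_def acgd_init_def dual_change_def momentum_def)

lemma sum_inner_gap_le:
  assumes l: "l \<in> nonneg_orthant" and N: "1 \<le> N"
  shows "(\<Sum>t = 1..N. \<Sum>s = 1..st_S p t. w t s * phase_gap t (y t s) l) \<le> dual_const / 2 * (norm l)\<^sup>2"
proof -
  have "(\<Sum>t = 1..N. \<Sum>s = 1..st_S p t. w t s * phase_gap t (y t s) l) + post N (st_S p N) l
      \<le> pre 1 1 l"
    using N
  proof (induction N rule: dec_induct)
    case base
    then show ?case using phase_potential[OF _ l, of 1] by simp
  next
    case (step N)
    then show ?case using phase_potential[OF _ l, of "Suc N"] pre_phase[of N l] by simp
  qed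
  then show ?thesis using post_nonneg[OF N, of l] unfolding pre_first by linarith
qed

lemma x_eq:
  assumes t: "1 \<le> t" shows "x t = (\<Sum>s = 1..st_S p t. (w t s / st_omega p t) *\<^sub>R y t s)"
proof -
  have "x t = (\<Sum>s = 1..st_S p t. st_delta p t s *\<^sub>R y t s) /\<^sub>R (\<Sum>s = 1..st_S p t. st_delta p t s)"
    using phase_end[OF t] by (simp add: acgd_phase_end_def)
  moreover have "w t s / st_omega p t = st_delta p t s / (\<Sum>s = 1..st_S p t. st_delta p t s)" for s
    using omega_pos[OF t] by (simp add: sc_weight_def)
  ultimately show ?thesis
    by (simp add: scaleR_sum_right divide_inverse mult.commute)
qed

lemma sum_normalized_weight: "1 \<le> t \<Longrightarrow> (\<Sum>s = 1..st_S p t. w t s / st_omega p t) = 1"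
  using sum_weight[of t] omega_pos[of t] by (simp flip: sum_divide_distrib)

lemma convex_on_u: "convex_on X u"
proof (rule convex_onI[OF _ cvx_X])
  fix t v z assume *: "0 < t" "t < (1::real)" "v \<in> X" "z \<in> X"
  have "u ((1 - t) *\<^sub>R v + t *\<^sub>R z)
     \<le> (1 - t) * u v + t * u z - \<alpha> / 2 * t * (1 - t) * (norm (v - z))\<^sup>2"
    using cvx_u * by (auto simp: strongly_convex_on_def)
  moreover have "0 \<le> \<alpha> / 2 * t * (1 - t) * (norm (v - z))\<^sup>2" using * alpha by simp
  ultimately show "u ((1 - t) *\<^sub>R v + t *\<^sub>R z) \<le> (1 - t) * u v + t * u z" by linarith
qed

lemma convex_on_phase_gap:
  assumes t: "1 \<le> t" shows "convex_on X (\<lambda>v. phase_gap t v l)"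
proof -
  have lin: "convex_on X (\<lambda>v. lin_f t v + l \<bullet> lin_g t v)"
  proof (rule convex_onI[OF _ cvx_X])
    fix s v z
    have "(1 - s) *\<^sub>R v + s *\<^sub>R z - xu t = (1 - s) *\<^sub>R (v - xu t) + s *\<^sub>R (z - xu t)"
      by (simp add: algebra_simps)
    then show "lin_f t ((1 - s) *\<^sub>R v + s *\<^sub>R z) + l \<bullet> lin_g t ((1 - s) *\<^sub>R v + s *\<^sub>R z)
        \<le> (1 - s) * (lin_f t v + l \<bullet> lin_g t v) + s * (lin_f t z + l \<bullet> lin_g t z)"
      by (simp add: lin_f_def lin_g_def inner_add_right matrix_vector_right_distrib
          matrix_vector_mult_scaleR algebra_simps)
  qed
  have "convex_on X (\<lambda>v. (lin_f t v + l \<bullet> lin_g t v) + (u v + st_eta p t / 2 * (norm (v - x (t - 1)))\<^sup>2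
      + (st_eta p t + \<alpha> / 2) / 2 * (norm (v - xs))\<^sup>2)
      + (- (st_eta p t / 2 * (norm (xs - x (t - 1)))\<^sup>2) - F_min))"
    using lin eta_pos[OF t] alpha cvx_X
    by (intro convex_on_add[OF convex_on_add[OF lin]] convex_on_add convex_on_cmul
        convex_on_norm_diff_power2 convex_on_u) (auto simp: convex_on_const)
  moreover have "(\<lambda>v. (lin_f t v + l \<bullet> lin_g t v) + (u v + st_eta p t / 2 * (norm (v - x (t - 1)))\<^sup>2
      + (st_eta p t + \<alpha> / 2) / 2 * (norm (v - xs))\<^sup>2)
      + (- (st_eta p t / 2 * (norm (xs - x (t - 1)))\<^sup>2) - F_min)) = (\<lambda>v. phase_gap t v l)"
    by (rule ext) (simp add: phase_gap_def norm_minus_commute)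
  ultimately show ?thesis by simp
qed

text \<open>Jensen's inequality: \<open>x t\<close> is the average of the inner points with the weights \<open>w t s\<close>, which add up
  to \<open>\<omega>\<^sub>t\<close>.\<close>

lemma phase_gap_average:
  assumes t: "1 \<le> t"
  shows "st_omega p t * phase_gap t (x t) l \<le> (\<Sum>s = 1..st_S p t. w t s * phase_gap t (y t s) l)"
proof -
  have "phase_gap t (x t) l \<le> (\<Sum>s = 1..st_S p t. (w t s / st_omega p t) * phase_gap t (y t s) l)"
    unfolding x_eq[OF t]
    using S_ge_1[OF t] sum_normalized_weight[OF t] weight_pos[OF t] omega_pos[OF t] y_in_X[OF t]
    by (intro convex_on_sum[OF _ _ convex_on_phase_gap[OF t]]) (auto intro: less_imp_le)
  then have "st_omega p t * phase_gap t (x t) l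
      \<le> st_omega p t * (\<Sum>s = 1..st_S p t. (w t s / st_omega p t) * phase_gap t (y t s) l)"
    using omega_pos[OF t] by (intro mult_left_mono) auto
  then show ?thesis using omega_pos[OF t] by (simp add: sum_distrib_left)
qed

lemma x_in_X:
  assumes t: "1 \<le> t" shows "x t \<in> X"
  unfolding x_eq[OF t]
  using S_ge_1[OF t] sum_normalized_weight[OF t] weight_pos[OF t] omega_pos[OF t] y_in_X[OF t]
  by (intro convex_sum cvx_X) (auto intro: less_imp_le)

lemma sum_phase_gap_le:
  assumes l: "l \<in> nonneg_orthant" and N: "1 \<le> N"
  shows "(\<Sum>t = 1..N. st_omega p t * phase_gap t (x t) l) \<le> dual_const / 2 * (norm l)\<^sup>2"
proof -
  have "(\<Sum>t = 1..N. st_omega p t * phase_gap t (x t) l)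
      \<le> (\<Sum>t = 1..N. \<Sum>s = 1..st_S p t. w t s * phase_gap t (y t s) l)"
    by (intro sum_mono phase_gap_average) simp
  then show ?thesis using sum_inner_gap_le[OF l N] by linarith
qed

section \<open>Acceleration in the outer loop\<close>

definition "lagr l z = f z + l \<bullet> g z"

definition "grad_lagr l z = grad f z + transpose (jac g z) *v l"

definition "bregman l v z = lagr l v - lagr l z - grad_lagr l z \<bullet> (v - z)"

lemma lin_lagr: "lin_f t v + l \<bullet> lin_g t v = lagr l (xu t) + grad_lagr l (xu t) \<bullet> (v - xu t)"
  unfolding lin_f_def lin_g_def lagr_def grad_lagr_def pi_eq nu_eq inner_add_left inner_transpose
  by (simp add: inner_add_right)

lemma convex_lagr: "l \<in> nonneg_orthant \<Longrightarrow> convex_on UNIV (lagr l)"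
proof (rule convex_onI)
  fix t :: real and v z
  assume l: "l \<in> nonneg_orthant" and t: "0 < t" "t < 1"
  have "l \<bullet> g ((1 - t) *\<^sub>R v + t *\<^sub>R z) \<le> l \<bullet> ((1 - t) *\<^sub>R g v + t *\<^sub>R g z)"
    using t convex_onD[OF cvx_g, of t] by (intro inner_nonneg_orthant_mono[OF l]) auto
  moreover have "f ((1 - t) *\<^sub>R v + t *\<^sub>R z) \<le> (1 - t) * f v + t * f z"
    using t convex_onD[OF cvx_f, of t] by auto
  ultimately show "lagr l ((1 - t) *\<^sub>R v + t *\<^sub>R z) \<le> (1 - t) * lagr l v + t * lagr l z"
    by (simp add: lagr_def inner_add_right algebra_simps)
qed simp

lemma nonneg_multiplier: "l \<in> multiplier_set ls c \<Longrightarrow> l \<in> nonneg_orthant"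
  using ls_nonneg by (auto simp: multiplier_set_def nonneg_orthant_def)

lemma bregman_ge:
  assumes l: "l \<in> multiplier_set ls c"
  shows "(norm (grad_lagr l v - grad_lagr l z))\<^sup>2 / (2 * L) \<le> bregman l v z"
proof -
  have nn: "l \<in> nonneg_orthant" by (rule nonneg_multiplier[OF l])
  have D: "GDERIV (lagr l) z :> grad_lagr l z" for z
    unfolding lagr_def grad_lagr_def by (rule GDERIV_lagrangian)
  have "grad (\<lambda>z. f z + l \<bullet> g z) = grad_lagr l"
    using GDERIV_imp_grad_eq[OF D] unfolding lagr_def by (intro ext)
  then have "(Lip l)-lipschitz_on UNIV (grad_lagr l)" using Lip[OF nn] by simp
  from bregman_ge_gradient_distance[OF D convex_lagr[OF nn] this Lip_le_L[OF l] L_pos]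
  show ?thesis unfolding bregman_def .
qed

lemma xu_eq:
  assumes "1 \<le> t"
  shows "(1 + st_tau p t) *\<^sub>R xu t
    = st_tau p t *\<^sub>R xu (t - 1) + (x (t - 1) + st_theta p t *\<^sub>R (x (t - 1) - x (t - 2)))"
  using outer_step[OF assms] tau_nonneg[OF assms] by (simp add: acgd_outer_step_def Let_def)

text \<open>How far the tangent of the Lagrangian at \<open>z\<close> lies above its tangent at the oracle point, both taken
  at \<open>x t\<close>. If \<open>z\<close> is the weighted average of the \<open>x t\<close>, the linear parts of the tangents at \<open>z\<close>
  cancel in the weighted sum, and the value of the Lagrangian at \<open>z\<close> is left.\<close>

definition "lin_error l z t = lagr l z + grad_lagr l z \<bullet> (x t - z) - (lin_f t (x t) + l \<bullet> lin_g t (x t))"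

text \<open>The oracle point is a weighted mean of its predecessor and the extrapolated point. Equivalently,
  the gradient at the oracle point is a proximal step in the dual space, with Bregman distances of
  the conjugate function; this is the corresponding three-point identity.\<close>

lemma lin_error_eq:
  assumes "1 \<le> t"
  shows "lin_error l z t
    = (x t - (x (t - 1) + st_theta p t *\<^sub>R (x (t - 1) - x (t - 2)))) \<bullet> (grad_lagr l z - grad_lagr l (xu t))
      + st_tau p t * bregman l (xu (t - 1)) z - st_tau p t * bregman l (xu (t - 1)) (xu t)
      - (1 + st_tau p t) * bregman l (xu t) z"
proof -
  have 1: "x (t - 1) + st_theta p t *\<^sub>R (x (t - 1) - x (t - 2))
      = (1 + st_tau p t) *\<^sub>R xu t - st_tau p t *\<^sub>R xu (t - 1)"
    using xu_eq[OF assms] by (simp add: algebra_simps)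
  show ?thesis unfolding 1 lin_error_def lin_lagr bregman_def
    by (simp add: inner_diff_left inner_diff_right inner_add_left inner_commute algebra_simps)
qed

text \<open>The Bregman distance controls the difference of gradients and \<open>\<eta>\<^sub>t\<close> the difference of points. The
  two constants match because \<open>\<tau>\<^sub>t\<^sub>+\<^sub>1 \<le> 1 + \<tau>\<^sub>t\<close>.\<close>

lemma dual_young:
  assumes t: "1 \<le> t" and l: "l \<in> multiplier_set ls c"
  shows "st_omega p t * ((x t - x (t - 1)) \<bullet> (grad_lagr l z - grad_lagr l v))
    \<le> st_omega p t * (1 + st_tau p t) * bregman l v z
      + st_omega p t * st_eta p t / 2 * (norm (x t - x (t - 1)))\<^sup>2"
proof -
  let ?T = "1 + st_tau p t"
  let ?D = "grad_lagr l z - grad_lagr l v"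
  have T: "0 < ?T" using tau_nonneg[OF t] by linarith
  have "(x t - x (t - 1)) \<bullet> ?D \<le> (norm ?D)\<^sup>2 / (2 * (L / ?T)) + L / ?T / 2 * (norm (x t - x (t - 1)))\<^sup>2"
    unfolding inner_commute[of "x t - x (t - 1)"] using T L_pos by (intro inner_le_sum_squares) simp
  also have "(norm ?D)\<^sup>2 / (2 * (L / ?T)) = ?T * ((norm ?D)\<^sup>2 / (2 * L))" by simp
  also have "\<dots> \<le> ?T * bregman l v z"
    using T bregman_ge[OF l, of v z] by (intro mult_left_mono) (auto simp: norm_minus_commute)
  also have "L / ?T / 2 * (norm (x t - x (t - 1)))\<^sup>2 \<le> st_eta p t / 2 * (norm (x t - x (t - 1)))\<^sup>2"
  proof (intro mult_right_mono divide_right_mono)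
    show "L / ?T \<le> st_eta p t"
      unfolding eta_eq[OF t] using L_pos T tau_pos[of "Suc t"] tau_Suc_le[of t] t
      by (intro divide_left_mono) auto
  qed auto
  finally have "st_omega p t * ((x t - x (t - 1)) \<bullet> ?D)
      \<le> st_omega p t * (?T * bregman l v z + st_eta p t / 2 * (norm (x t - x (t - 1)))\<^sup>2)"
    using omega_pos[OF t] by (intro mult_left_mono) auto
  then show ?thesis by (simp add: algebra_simps)
qed

text \<open>The weights satisfy \<open>\<omega>\<^sub>t\<^sub>+\<^sub>1 \<tau>\<^sub>t\<^sub>+\<^sub>1 = \<omega>\<^sub>t (1 + \<tau>\<^sub>t)\<close>, which telescopes the Bregman distances to \<open>z\<close>, and
  \<open>\<omega>\<^sub>t\<^sub>+\<^sub>1 \<theta>\<^sub>t\<^sub>+\<^sub>1 = \<omega>\<^sub>t\<close>, which telescopes the extrapolation up to the change of the gradient between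
  consecutive oracle points. That change is paid for by \<open>dual_young\<close>. The induction needs the last
  momentum and the last Bregman distance in its statement; \<open>dual_young\<close> removes them at the end.\<close>

lemma sum_lin_error_le:
  assumes l: "l \<in> multiplier_set ls c" and N: "1 \<le> N"
  shows "(\<Sum>t = 1..N. st_omega p t * lin_error l z t)
    \<le> (\<Sum>t = 1..N. st_omega p t * st_eta p t / 2 * (norm (x t - x (t - 1)))\<^sup>2)"
proof -
  let ?E = "\<lambda>t. st_omega p t * st_eta p t / 2 * (norm (x t - x (t - 1)))\<^sup>2"
  let ?mom = "\<lambda>t v. st_omega p t * ((x t - x (t - 1)) \<bullet> (grad_lagr l z - grad_lagr l v))"
  have "(\<Sum>t = 1..N. st_omega p t * lin_error l z t) + st_omega p N * (1 + st_tau p N) * bregman l (xu N) z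
      - ?mom N (xu N) \<le> (\<Sum>t = 1..<N. ?E t)"
    using N
  proof (induction N rule: dec_induct)
    case base
    have "lin_error l z 1 = (x 1 - x 0) \<bullet> (grad_lagr l z - grad_lagr l (xu 1)) - bregman l (xu 1) z"
      using lin_error_eq[of 1 l z] tau_1 theta_1 by simp
    then show ?case using tau_1 by (simp add: omega_1[simplified])
  next
    case (step N)
    let ?M = "Suc N"
    have a: "st_omega p ?M * (st_tau p ?M * B) = st_omega p N * (1 + st_tau p N) * B" for B
      using omega_tau[OF step(1)] by simp
    have th: "st_omega p ?M *\<^sub>R (st_theta p ?M *\<^sub>R v) = st_omega p N *\<^sub>R v" for v :: "real^'n"
      using omega_theta[OF step(1)] by simp
    define dG where "dG = grad_lagr l z - grad_lagr l (xu ?M)"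
    have b: "st_omega p ?M * ((x ?M - (x N + st_theta p ?M *\<^sub>R (x N - x (N - 1)))) \<bullet> dG)
        = ?mom ?M (xu ?M) - st_omega p N * ((x N - x (N - 1)) \<bullet> dG)"
    proof -
      have "st_omega p ?M *\<^sub>R (x ?M - (x N + st_theta p ?M *\<^sub>R (x N - x (N - 1))))
          = st_omega p ?M *\<^sub>R (x ?M - x N) - st_omega p N *\<^sub>R (x N - x (N - 1))"
        unfolding th[symmetric] by (simp add: algebra_simps)
      then have "(st_omega p ?M *\<^sub>R (x ?M - (x N + st_theta p ?M *\<^sub>R (x N - x (N - 1))))) \<bullet> dG
          = (st_omega p ?M *\<^sub>R (x ?M - x N) - st_omega p N *\<^sub>R (x N - x (N - 1))) \<bullet> dG"
        by (rule arg_cong)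
      then show ?thesis unfolding inner_diff_left inner_scaleR_left dG_def
        by (simp add: inner_diff_left inner_add_left)
    qed
    have "st_omega p ?M * lin_error l z ?M
        = st_omega p ?M * ((x ?M - (x N + st_theta p ?M *\<^sub>R (x N - x (N - 1)))) \<bullet> dG)
          + st_omega p ?M * (st_tau p ?M * bregman l (xu N) z)
          - st_omega p ?M * (st_tau p ?M * bregman l (xu N) (xu ?M))
          - st_omega p ?M * (1 + st_tau p ?M) * bregman l (xu ?M) z"
      using lin_error_eq[of ?M l z] unfolding dG_def
      by (simp add: distrib_left right_diff_distrib mult.assoc numeral_2_eq_2)
    then have c: "st_omega p ?M * lin_error l z ?M
        = ?mom ?M (xu ?M) - st_omega p N * ((x N - x (N - 1)) \<bullet> dG)
          + st_omega p N * (1 + st_tau p N) * bregman l (xu N) z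
          - st_omega p N * (1 + st_tau p N) * bregman l (xu N) (xu ?M)
          - st_omega p ?M * (1 + st_tau p ?M) * bregman l (xu ?M) z"
      unfolding a b .
    have e: "st_omega p N * ((x N - x (N - 1)) \<bullet> (grad_lagr l (xu ?M) - grad_lagr l (xu N)))
        = ?mom N (xu N) - st_omega p N * ((x N - x (N - 1)) \<bullet> dG)"
      by (simp add: dG_def inner_diff_right algebra_simps)
    have f: "st_omega p N * ((x N - x (N - 1)) \<bullet> (grad_lagr l (xu ?M) - grad_lagr l (xu N)))
        \<le> st_omega p N * (1 + st_tau p N) * bregman l (xu N) (xu ?M) + ?E N"
      by (rule dual_young[OF step(1) l])
    show ?case using step.IH c e f step(1) by simp
  qed
  moreover have "?mom N (xu N) \<le> st_omega p N * (1 + st_tau p N) * bregman l (xu N) z + ?E N"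
    by (rule dual_young[OF N l])
  moreover have "(\<Sum>t = 1..N. ?E t) = (\<Sum>t = 1..<N. ?E t) + ?E N"
    using N by (cases N) (auto simp: atLeastLessThanSuc_atLeastAtMost)
  ultimately show ?thesis by linarith
qed

section \<open>The gap of the output\<close>

text \<open>By \<open>omega_eta\<close>, what phase \<open>t + 1\<close> takes from the distance of \<open>x t\<close> to \<open>x\<^sup>*\<close> is covered by what phase
  \<open>t\<close> has left.\<close>

lemma sum_prox_telescope:
  assumes N: "1 \<le> N"
  shows "st_omega p N * (st_eta p N + \<alpha> / 2) / 2 * (norm (xs - x N))\<^sup>2 - L * (norm (x0 - xs))\<^sup>2
    \<le> (\<Sum>t = 1..N. st_omega p t * ((st_eta p t + \<alpha> / 2) / 2 * (norm (xs - x t))\<^sup>2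
        - st_eta p t / 2 * (norm (xs - x (t - 1)))\<^sup>2))"
  using N
proof (induction N rule: dec_induct)
  case base
  have "x 0 = x0" using init by (simp add: acgd_init_def)
  then show ?case by (simp add: omega_1[simplified] eta_1[simplified] norm_minus_commute)
next
  case (step N)
  have "st_omega p (Suc N) * st_eta p (Suc N) * (norm (xs - x N))\<^sup>2
      \<le> st_omega p N * (st_eta p N + \<alpha> / 2) * (norm (xs - x N))\<^sup>2"
    using omega_eta[OF step(1)] by (rule mult_right_mono) simp
  then show ?case using step.IH by (simp add: algebra_simps)
qed

definition "Omega N = (\<Sum>t = 1..N. st_omega p t)"

lemma Omega_pos: "1 \<le> N \<Longrightarrow> 0 < Omega N"
  unfolding Omega_def by (intro sum_pos omega_pos) auto

lemma output_eq: "Omega N *\<^sub>R acgd_output p r N = (\<Sum>t = 1..N. st_omega p t *\<^sub>R x t)" if "1 \<le> N"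
  using Omega_pos[OF that] by (simp add: acgd_output_def Omega_def)

lemma output_average:
  "1 \<le> N \<Longrightarrow> acgd_output p r N = (\<Sum>t = 1..N. (st_omega p t / Omega N) *\<^sub>R x t)"
  by (simp add: acgd_output_def Omega_def scaleR_sum_right divide_inverse mult.commute)

lemma sum_normalized_omega: "1 \<le> N \<Longrightarrow> (\<Sum>t = 1..N. st_omega p t / Omega N) = 1"
  using Omega_pos[of N] by (simp add: Omega_def flip: sum_divide_distrib)

lemma output_in_X: "1 \<le> N \<Longrightarrow> acgd_output p r N \<in> X"
  unfolding output_average using sum_normalized_omega[of N] omega_pos Omega_pos[of N] x_in_X
  by (intro convex_sum cvx_X) (auto intro!: less_imp_le)

lemma u_output_le:
  assumes N: "1 \<le> N"
  shows "Omega N * u (acgd_output p r N) \<le> (\<Sum>t = 1..N. st_omega p t * u (x t))"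
proof -
  have "u (acgd_output p r N) \<le> (\<Sum>t = 1..N. (st_omega p t / Omega N) * u (x t))"
    unfolding output_average[OF N]
    using N sum_normalized_omega[OF N] omega_pos Omega_pos[OF N] x_in_X
    by (intro convex_on_sum[OF _ _ convex_on_u]) (auto intro!: less_imp_le)
  then have "Omega N * u (acgd_output p r N) \<le> Omega N * (\<Sum>t = 1..N. (st_omega p t / Omega N) * u (x t))"
    using Omega_pos[OF N] by (intro mult_left_mono) auto
  then show ?thesis using Omega_pos[OF N] by (simp add: sum_distrib_left)
qed

text \<open>In the sum of \<open>sum_phase_gap_le\<close> and \<open>sum_lin_error_le\<close> the terms \<open>\<parallel>x\<^sup>t - x\<^sup>t\<^sup>-\<^sup>1\<parallel>\<^sup>2\<close> cancel.\<close>

lemma gap_bound: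
  assumes l: "l \<in> multiplier_set ls c" and N: "1 \<le> N"
  defines "z \<equiv> acgd_output p r N"
  shows "Omega N * (lagr l z + u z - F_min)
      + st_omega p N * (st_eta p N + \<alpha> / 2) / 2 * (norm (xs - x N))\<^sup>2
    \<le> L * (norm (x0 - xs))\<^sup>2 + dual_const / 2 * (norm l)\<^sup>2"
proof -
  define P where "P t = st_omega p t * ((st_eta p t + \<alpha> / 2) / 2 * (norm (xs - x t))\<^sup>2
        - st_eta p t / 2 * (norm (xs - x (t - 1)))\<^sup>2)" for t
  define E where "E t = st_omega p t * st_eta p t / 2 * (norm (x t - x (t - 1)))\<^sup>2" for t
  have id: "st_omega p t * phase_gap t (x t) l + (st_omega p t * lin_error l z t - E t)
     = st_omega p t * (lagr l z - F_min) + st_omega p t * u (x t) + P t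
       + grad_lagr l z \<bullet> (st_omega p t *\<^sub>R x t - st_omega p t *\<^sub>R z)" for t
    unfolding phase_gap_def lin_error_def P_def E_def by (simp add: inner_diff_right algebra_simps)
  have lin0: "(\<Sum>t = 1..N. st_omega p t *\<^sub>R x t - st_omega p t *\<^sub>R z) = 0"
    using output_eq[OF N] by (simp add: sum_subtractf z_def Omega_def scaleR_sum_left)
  have "(\<Sum>t = 1..N. st_omega p t * (lagr l z - F_min) + st_omega p t * u (x t) + P t
       + grad_lagr l z \<bullet> (st_omega p t *\<^sub>R x t - st_omega p t *\<^sub>R z))
     = Omega N * (lagr l z - F_min) + (\<Sum>t = 1..N. st_omega p t * u (x t)) + (\<Sum>t = 1..N. P t)"
    unfolding sum.distrib inner_sum_right[symmetric] lin0
    by (simp add: Omega_def sum_distrib_right)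
  also have "(\<Sum>t = 1..N. st_omega p t * (lagr l z - F_min) + st_omega p t * u (x t) + P t
       + grad_lagr l z \<bullet> (st_omega p t *\<^sub>R x t - st_omega p t *\<^sub>R z))
     = (\<Sum>t = 1..N. st_omega p t * phase_gap t (x t) l)
       + ((\<Sum>t = 1..N. st_omega p t * lin_error l z t) - (\<Sum>t = 1..N. E t))"
    unfolding id[symmetric] by (simp add: sum.distrib sum_subtractf)
  finally have eq: "Omega N * (lagr l z - F_min) + (\<Sum>t = 1..N. st_omega p t * u (x t)) + (\<Sum>t = 1..N. P t)
     = (\<Sum>t = 1..N. st_omega p t * phase_gap t (x t) l)
       + ((\<Sum>t = 1..N. st_omega p t * lin_error l z t) - (\<Sum>t = 1..N. E t))" by simp
  have "(\<Sum>t = 1..N. st_omega p t * lin_error l z t) - (\<Sum>t = 1..N. E t) \<le> 0"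
    using sum_lin_error_le[OF l N, of z] by (simp add: E_def)
  moreover have "(\<Sum>t = 1..N. st_omega p t * phase_gap t (x t) l) \<le> dual_const / 2 * (norm l)\<^sup>2"
    by (rule sum_phase_gap_le[OF nonneg_multiplier[OF l] N])
  moreover have "Omega N * u z \<le> (\<Sum>t = 1..N. st_omega p t * u (x t))"
    unfolding z_def by (rule u_output_le[OF N])
  moreover have "st_omega p N * (st_eta p N + \<alpha> / 2) / 2 * (norm (xs - x N))\<^sup>2 - L * (norm (x0 - xs))\<^sup>2
     \<le> (\<Sum>t = 1..N. P t)"
    unfolding P_def by (rule sum_prox_telescope[OF N])
  moreover have "Omega N * (lagr l z + u z - F_min) = Omega N * (lagr l z - F_min) + Omega N * u z"
    by (simp add: algebra_simps)
  ultimately show ?thesis using eq by linarith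
qed

text \<open>The quantity \<open>A\<close> of the complexity bounds.\<close>

definition "initial_dist = (norm (x0 - xs))\<^sup>2 + 2 * (norm ls + c)\<^sup>2 / R\<^sup>2"

lemma initial_dist_pos: "0 < initial_dist"
proof -
  have "0 < (norm ls + c)\<^sup>2" using c by (simp add: add_nonneg_eq_0_iff)
  then have "0 < 2 * (norm ls + c)\<^sup>2 / R\<^sup>2" using R by simp
  then show ?thesis unfolding initial_dist_def by (simp add: add_nonneg_pos)
qed

lemma multiplier_norm:
  assumes "l \<in> multiplier_set ls c" shows "norm l \<le> norm ls + c"
proof -
  have "norm (ls + k) \<le> norm ls + c" if "norm k \<le> c" for k
    using norm_triangle_ineq[of ls k] that by linarith
  moreover have "0 \<le> norm ls + c" using c norm_ge_zero[of ls] by linarith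
  ultimately show ?thesis using assms by (auto simp: multiplier_set_def)
qed

lemma gap_bound_uniform:
  assumes l: "l \<in> multiplier_set ls c" and N: "1 \<le> N"
  shows "Omega N * (lagr l (acgd_output p r N) + u (acgd_output p r N) - F_min)
      + st_omega p N * (st_eta p N + \<alpha> / 2) / 2 * (norm (xs - x N))\<^sup>2 \<le> L * initial_dist"
proof -
  have dc: "dual_const / 2 = 2 * L / R\<^sup>2"
    using alpha L_pos R by (simp add: dual_const_def \<Delta>_def)
  have "dual_const / 2 * (norm l)\<^sup>2 \<le> dual_const / 2 * (norm ls + c)\<^sup>2"
    using multiplier_norm[OF l] dual_const_pos by (intro mult_left_mono power_mono) auto
  also have "\<dots> = L * (2 * (norm ls + c)\<^sup>2 / R\<^sup>2)" unfolding dc by simp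
  finally show ?thesis using gap_bound[OF l N] unfolding initial_dist_def by (simp only: distrib_left)
qed

section \<open>Approximate optimality and boundedness\<close>

text \<open>The Lagrangian with the optimal multiplier is convex, and by the KKT conditions \<open>x\<^sup>*\<close> minimises it over
  \<open>X\<close> with value \<open>F\<^sub>*\<close>.\<close>

lemma kkt_lower_bound:
  assumes z: "z \<in> X" shows "F_min \<le> lagr ls z + u z"
proof -
  have g1: "grad (\<lambda>z. g z $ i) xs = jac g xs $ i" for i
    by (rule GDERIV_imp_grad_eq[OF GDERIV_g])
  obtain u' where u': "u' \<in> subdiff_on X u xs"
    and nc: "- (grad f xs + (\<Sum>i\<in>UNIV. (ls $ i) *\<^sub>R (jac g xs $ i)) + u') \<in> normal_cone X xs"
    and cs: "\<And>i. ls $ i * g xs $ i = 0"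
    using kkt unfolding kkt_pair_def g1 by blast
  have "- (grad f xs + (\<Sum>i\<in>UNIV. (ls $ i) *\<^sub>R (jac g xs $ i)) + u') \<bullet> (z - xs) \<le> 0"
    using nc z unfolding normal_cone_def by blast
  then have "0 \<le> (grad f xs + (\<Sum>i\<in>UNIV. (ls $ i) *\<^sub>R (jac g xs $ i)) + u') \<bullet> (z - xs)"
    by (simp only: inner_minus_left)
  then have 1: "0 \<le> grad f xs \<bullet> (z - xs) + (\<Sum>i\<in>UNIV. (ls $ i) *\<^sub>R (jac g xs $ i)) \<bullet> (z - xs) + u' \<bullet> (z - xs)"
    by (simp only: inner_add_left)
  have 2: "f xs + grad f xs \<bullet> (z - xs) \<le> f z"
    by (rule convex_on_above_gradient[OF cvx_f GDERIV_f])
  have 3: "u xs + u' \<bullet> (z - xs) \<le> u z" using u' z by (auto simp: subdiff_on_def)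
  have "(\<Sum>i\<in>UNIV. (ls $ i) *\<^sub>R (jac g xs $ i)) \<bullet> (z - xs)
      = (\<Sum>i\<in>UNIV. ls $ i * (g xs $ i + jac g xs $ i \<bullet> (z - xs)))"
    by (simp add: inner_sum_left distrib_left cs)
  also have "\<dots> \<le> (\<Sum>i\<in>UNIV. ls $ i * g z $ i)"
    using ls_nonneg convex_on_above_gradient[OF cvx_g GDERIV_g]
    by (intro sum_mono mult_left_mono) (auto simp: nonneg_orthant_def)
  also have "\<dots> = ls \<bullet> g z" by (simp add: inner_vec_def)
  finally show ?thesis using 1 2 3 unfolding F_min_def lagr_def by linarith
qed

lemma ls_multiplier: "ls \<in> multiplier_set ls c"
  using c by (auto simp: multiplier_set_def nonneg_orthant_def intro!: exI[of _ 0])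

text \<open>The gap bound for \<open>\<lambda> = 0\<close> controls the objective. For the constraints, \<open>\<lambda>\<^sup>*\<close> is perturbed by a vector
  of length \<open>c\<close> in the direction of the violation, which turns the violation into a gap.\<close>

lemma output_approx_optimal:
  assumes N: "1 \<le> N" and eps: "L * initial_dist \<le> Omega N * \<epsilon>"
  shows "approx_optimal (\<lambda>z. f z + u z) (f xs + u xs) g \<epsilon> (\<epsilon> / c) (acgd_output p r N)"
proof -
  define z where "z = acgd_output p r N"
  have zX: "z \<in> X" unfolding z_def by (rule output_in_X[OF N])
  have key: "lagr l z + u z - F_min \<le> \<epsilon>" if l: "l \<in> multiplier_set ls c" for l
  proof -
    have "0 \<le> st_omega p N * (st_eta p N + \<alpha> / 2) / 2 * (norm (xs - x N))\<^sup>2"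
      using omega_pos[OF N] eta_pos[OF N] alpha by simp
    then have "Omega N * (lagr l z + u z - F_min) \<le> Omega N * \<epsilon>"
      using gap_bound_uniform[OF l N] eps unfolding z_def by linarith
    then show ?thesis using Omega_pos[OF N] by simp
  qed
  have 1: "f z + u z - F_min \<le> \<epsilon>"
    using key[of 0] by (simp add: multiplier_set_def lagr_def)
  define v where "v = pos_part (g z)"
  have "norm v \<le> \<epsilon> / c"
  proof (cases "v = 0")
    case True
    have "0 < L * initial_dist" using L_pos initial_dist_pos by simp
    then have "0 < Omega N * \<epsilon>" using eps by linarith
    then have "0 < \<epsilon>" using Omega_pos[OF N] by (simp add: zero_less_mult_iff)
    then show ?thesis using True c by simp
  next
    case False
    \<comment> \<open>the worst multiplier in \<open>\<Lambda>\<^sub>c\<close> for the point \<open>z\<close> is \<open>\<lambda>\<^sup>* + k\<close>\<close>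
    define k where "k = (c / norm v) *\<^sub>R v"
    have "k \<in> nonneg_orthant" using c by (simp add: k_def v_def pos_part_def nonneg_orthant_def)
    moreover have "norm k = c" using False c by (simp add: k_def)
    ultimately have "ls + k \<in> multiplier_set ls c" by (auto simp: multiplier_set_def)
    from key[OF this] have "lagr ls z + k \<bullet> g z + u z - F_min \<le> \<epsilon>"
      by (simp add: lagr_def inner_add_left)
    then have kg: "k \<bullet> g z \<le> \<epsilon>" using kkt_lower_bound[OF zX] by linarith
    have "v \<bullet> g z = v \<bullet> v"
      by (auto simp: v_def pos_part_def inner_vec_def max_def intro!: sum.cong)
    then have "k \<bullet> g z = c * norm v"
      using False by (simp add: k_def dot_square_norm power2_eq_square)
    then show ?thesis using kg c by (simp add: field_simps)
  qed
  then show ?thesis using 1 unfolding approx_optimal_def z_def v_def F_min_def by simp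
qed

text \<open>At \<open>\<lambda> = \<lambda>\<^sup>*\<close> the gap is nonnegative, so the distance term of the gap bound is bounded on its own.\<close>

lemma x_dist: "1 \<le> t \<Longrightarrow> (norm (xs - x t))\<^sup>2 \<le> 4 * L * initial_dist / \<alpha>"
proof -
  assume t: "1 \<le> t"
  have "0 \<le> Omega t * (lagr ls (acgd_output p r t) + u (acgd_output p r t) - F_min)"
    using Omega_pos[OF t] kkt_lower_bound[OF output_in_X[OF t]] by simp
  then have "st_omega p t * (st_eta p t + \<alpha> / 2) / 2 * (norm (xs - x t))\<^sup>2 \<le> L * initial_dist"
    using gap_bound_uniform[OF ls_multiplier t] by linarith
  moreover have "\<alpha> / 4 * (norm (xs - x t))\<^sup>2
      \<le> st_omega p t * (st_eta p t + \<alpha> / 2) / 2 * (norm (xs - x t))\<^sup>2"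
  proof (rule mult_right_mono)
    \<comment> \<open>a bound independent of \<open>t\<close>: drop \<open>\<eta>\<^sub>t\<close>, which is positive, and use \<open>\<omega>\<^sub>t \<ge> 1\<close>\<close>
    have "1 * (\<alpha> / 2) \<le> st_omega p t * (st_eta p t + \<alpha> / 2)"
      using omega_ge_1[of "t - 1"] eta_pos[OF t] t alpha by (intro mult_mono) auto
    then show "\<alpha> / 4 \<le> st_omega p t * (st_eta p t + \<alpha> / 2) / 2" by simp
  qed simp
  ultimately show ?thesis using alpha by (simp add: field_simps)
qed

text \<open>The iterates lie in a ball around \<open>x\<^sup>*\<close> by \<open>x_dist\<close>. Extrapolation with \<open>\<theta> \<le> 1\<close> at most triples the
  radius, and the oracle points are averages of such points.\<close>

lemma bounded_xu: "bounded (range xu)"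
proof -
  define B where "B = max (norm (x0 - xs)) (sqrt (4 * L * initial_dist / \<alpha>))"
  have x: "norm (x t - xs) \<le> B" for t
  proof (cases t)
    case 0
    then show ?thesis using init by (simp add: B_def acgd_init_def)
  next
    case (Suc k)
    then have "norm (xs - x t) \<le> sqrt (4 * L * initial_dist / \<alpha>)"
      using x_dist[of t] by (intro real_le_rsqrt) simp
    then show ?thesis by (simp add: B_def norm_minus_commute)
  qed
  have B: "0 \<le> B" using norm_ge_zero[of "x0 - xs"] unfolding B_def by linarith
  have xu: "norm (xu t - xs) \<le> 3 * B" for t
  proof (induction t)
    case 0
    have "xu 0 = x 0" using init by (simp add: acgd_init_def)
    then show ?case using x[of 0] B by simp
  next
    case (Suc t)
    let ?t = "Suc t"
    let ?T = "st_tau p ?t"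
    let ?th = "st_theta p ?t"
    have T: "0 \<le> ?T" by (rule tau_nonneg) simp
    have th: "0 \<le> ?th" "?th \<le> 1"
      using theta_nonneg[of t] theta_le_1[of t] theta_1 by (cases t; simp)+
    have e: "(1 + ?T) *\<^sub>R (xu ?t - xs) = ?T *\<^sub>R (xu t - xs)
        + ((x t - xs) + ?th *\<^sub>R ((x t - xs) - (x (?t - 2) - xs)))"
      using xu_eq[of ?t] by (simp add: algebra_simps)
    have "(1 + ?T) * norm (xu ?t - xs) = norm ((1 + ?T) *\<^sub>R (xu ?t - xs))" using T by simp
    also have "\<dots> \<le> norm (?T *\<^sub>R (xu t - xs)) + (norm (x t - xs)
        + norm (?th *\<^sub>R ((x t - xs) - (x (?t - 2) - xs))))"
      unfolding e by (intro order_trans[OF norm_triangle_ineq] add_left_mono norm_triangle_ineq)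
    also have "\<dots> \<le> ?T * (3 * B) + (B + 1 * (B + B))"
    proof (intro add_mono)
      show "norm (?T *\<^sub>R (xu t - xs)) \<le> ?T * (3 * B)"
        using T Suc by (simp add: mult_left_mono)
      have "norm ((x t - xs) - (x (?t - 2) - xs)) \<le> B + B"
        using norm_triangle_ineq4[of "x t - xs" "x (?t - 2) - xs"] x[of t] x[of "?t - 2"] by linarith
      then show "norm (?th *\<^sub>R ((x t - xs) - (x (?t - 2) - xs))) \<le> 1 * (B + B)"
        using th B unfolding norm_scaleR by (intro mult_mono) auto
    qed (rule x)
    also have "\<dots> = (1 + ?T) * (3 * B)" by (simp add: algebra_simps)
    finally show ?case using T by simp
  qed
  have "norm (xu t) \<le> 3 * B + norm xs" for t
    using xu[of t] norm_triangle_ineq2[of "xu t" xs] by linarith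
  then show ?thesis by (auto simp: bounded_iff)
qed

section \<open>Complexity\<close>

text \<open>A geometric series with the ratio of \<open>omega_ge_power\<close>.\<close>

lemma Omega_ge: "2 * \<sigma> * ((1 + 1 / (2 * \<sigma>)) ^ N - 1) \<le> Omega N"
proof (induction N)
  case 0
  then show ?case by (simp add: Omega_def)
next
  case (Suc N)
  define q where "q = 1 + 1 / (2 * \<sigma>)"
  have "2 * \<sigma> * (q - 1) = 1" using sigma_ge_1 by (simp add: q_def)
  then have "2 * \<sigma> * (q - 1) * q ^ N = q ^ N" by simp
  then have "2 * \<sigma> * (q ^ Suc N - 1) = 2 * \<sigma> * (q ^ N - 1) + q ^ N"
    by (simp add: algebra_simps)
  also have "\<dots> \<le> Omega N + st_omega p (Suc N)"
    unfolding q_def by (rule add_mono[OF Suc.IH omega_ge_power])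
  finally show ?case by (simp add: Omega_def q_def)
qed

lemma Omega_Suc_le:
  assumes "1 \<le> N" shows "Omega (Suc N) \<le> 3 * Omega N"
proof -
  have "st_omega p N \<le> Omega N"
    unfolding Omega_def using omega_pos assms by (intro member_le_sum) (auto intro: less_imp_le)
  then show ?thesis using omega_Suc_le[OF assms] by (simp add: Omega_def)
qed

lemma sqrt_L_alpha_le: "sqrt (L * \<alpha>) \<le> L"
  using L_pos alpha alpha_le_L by (intro real_le_lsqrt) (auto simp: power2_eq_square)

text \<open>With \<open>E = sqrt (L \<alpha>) A / \<epsilon>\<close> and \<open>q = 1 + 1 / (2 \<sigma>)\<close>, the hypothesis on \<open>N\<close> and \<open>ln q \<ge> 1 / (4 \<sigma>)\<close> give
  \<open>q\<^sup>N \<ge> E\<^sup>2\<close>. The upper bound on \<open>\<epsilon>\<close> means \<open>E\<^sup>2 \<ge> 2\<close>, so the subtraction of 1 in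
  \<open>Omega_ge\<close> costs at most half.\<close>

lemma Omega_large:
  assumes eps: "0 < \<epsilon>" "\<epsilon> \<le> sqrt (L * \<alpha>) * initial_dist / sqrt 2"
    and N: "8 * \<sigma> * ln (sqrt (L * \<alpha>) * initial_dist / \<epsilon>) \<le> real N"
  shows "1 \<le> N" "L * initial_dist \<le> Omega N * \<epsilon>"
proof -
  define E where "E = sqrt (L * \<alpha>) * initial_dist / \<epsilon>"
  have E: "sqrt 2 \<le> E" using eps by (simp add: E_def field_simps)
  have s2: "1 < sqrt 2" by simp
  have E1: "1 < E" using E s2 by linarith
  have N': "8 * \<sigma> * ln E \<le> real N" using N by (simp add: E_def)
  have "0 < 8 * \<sigma> * ln E" using E1 sigma_ge_1 by simp
  then have "0 < real N" using N' by linarith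
  then show "1 \<le> N" by simp
  define q where "q = 1 + 1 / (2 * \<sigma>)"
  have q: "1 < q" using sigma_ge_1 by (simp add: q_def)
  have "1 / (4 * \<sigma>) \<le> ln q"
  proof -
    define e where "e = 1 / (2 * \<sigma>)"
    have e: "0 \<le> e" "e \<le> 1 / 2" using sigma_ge_1 by (auto simp: e_def field_simps)
    have "e - e\<^sup>2 \<le> ln (1 + e)" using e by (intro ln_one_plus_pos_lower_bound) auto
    moreover have "e * e \<le> e * (1 / 2)" by (rule mult_left_mono[OF e(2,1)])
    moreover have "1 / (4 * \<sigma>) = e / 2" by (simp add: e_def)
    moreover have "e\<^sup>2 = e * e" by (rule power2_eq_square)
    ultimately have "1 / (4 * \<sigma>) \<le> ln (1 + e)" by linarith
    then show ?thesis by (simp only: q_def e_def)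
  qed
  then have "8 * \<sigma> * ln E * (1 / (4 * \<sigma>)) \<le> real N * ln q"
    using N' E1 sigma_ge_1 by (intro mult_mono) auto
  moreover have "8 * \<sigma> * ln E * (1 / (4 * \<sigma>)) = ln (E\<^sup>2)"
    using E1 sigma_ge_1 by (simp add: ln_realpow)
  ultimately have "ln (E\<^sup>2) \<le> ln (q ^ N)" using q by (simp add: ln_realpow)
  then have "E\<^sup>2 \<le> q ^ N" using E1 q by (subst (asm) ln_le_cancel_iff) auto
  then have "2 * \<sigma> * (E\<^sup>2 - 1) \<le> 2 * \<sigma> * (q ^ N - 1)"
    using sigma_ge_1 by (intro mult_left_mono) auto
  also have "\<dots> \<le> Omega N" unfolding q_def by (rule Omega_ge)
  finally have 1: "2 * \<sigma> * (E\<^sup>2 - 1) \<le> Omega N" .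
  have "(sqrt 2)\<^sup>2 \<le> E\<^sup>2" using E by (intro power_mono) auto
  then have "2 \<le> E\<^sup>2" by simp
  moreover have "E \<le> E\<^sup>2" using E1 by (simp add: power2_eq_square)
  ultimately have "E \<le> 2 * (E\<^sup>2 - 1)" by simp
  then have "\<sigma> * E \<le> 2 * \<sigma> * (E\<^sup>2 - 1)"
    using sigma_ge_1 mult_left_mono[of E "2 * (E\<^sup>2 - 1)" \<sigma>] by (simp add: mult_ac)
  then have "\<sigma> * E * \<epsilon> \<le> Omega N * \<epsilon>"
    using 1 eps by (intro mult_right_mono) auto
  moreover have "sqrt (L / \<alpha>) * sqrt (L * \<alpha>) \<le> \<sigma> * sqrt (L * \<alpha>)"
  proof (rule mult_right_mono)
    have "0 \<le> L / \<alpha>" using L_pos alpha by simp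
    then show "sqrt (L / \<alpha>) \<le> \<sigma>" unfolding \<sigma>_def by (intro real_sqrt_le_mono) linarith
    show "0 \<le> sqrt (L * \<alpha>)" using L_pos alpha by simp
  qed
  moreover have "sqrt (L / \<alpha>) * sqrt (L * \<alpha>) = L"
    using L_pos alpha by (simp flip: real_sqrt_mult)
  ultimately have "L * initial_dist \<le> \<sigma> * sqrt (L * \<alpha>) * initial_dist"
    using initial_dist_pos by (intro mult_right_mono) auto
  also have "\<dots> = \<sigma> * E * \<epsilon>" using eps by (simp add: E_def)
  also have "\<dots> \<le> Omega N * \<epsilon>" by fact
  finally show "L * initial_dist \<le> Omega N * \<epsilon>" .
qed

abbreviation "is_done \<epsilon> \<equiv> approx_optimal (\<lambda>z. f z + u z) (f xs + u xs) g \<epsilon> (\<epsilon> / c)"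

lemma oracle_count_bound:
  assumes eps: "0 < \<epsilon>" "\<epsilon> \<le> sqrt (L * \<alpha>) * initial_dist / sqrt 2"
  shows "\<exists>N\<ge>1. is_done \<epsilon> (acgd_output p r N)"
    and "real (oracle_count (is_done \<epsilon>) p r)
      \<le> 8 * \<sigma> * ln (sqrt (L * \<alpha>) * initial_dist / \<epsilon>) + 1"
proof -
  define b where "b = 8 * \<sigma> * ln (sqrt (L * \<alpha>) * initial_dist / \<epsilon>)"
  define N where "N = nat \<lceil>b\<rceil>"
  have "b \<le> real N" unfolding N_def by linarith
  from Omega_large[OF eps this[unfolded b_def]] have N: "1 \<le> N" "is_done \<epsilon> (acgd_output p r N)"
    using output_approx_optimal by blast+
  then show "\<exists>N\<ge>1. is_done \<epsilon> (acgd_output p r N)" by blast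
  have "oracle_count (is_done \<epsilon>) p r \<le> N"
    unfolding oracle_count_def using N by (intro Least_le) auto
  moreover have "real N \<le> b + 1" using N(1) unfolding N_def by linarith
  ultimately show "real (oracle_count (is_done \<epsilon>) p r) \<le> b + 1" by linarith
qed

text \<open>The last phase but one did not meet the criterion, so its \<open>\<Omega>\<close> is below \<open>L A / \<epsilon>\<close>, and one more phase
  at most triples it. If there is only one phase, then \<open>\<Omega> = 1\<close>, and the upper bound on \<open>\<epsilon>\<close> suffices
  as \<open>sqrt (L \<alpha>) \<le> L\<close>.\<close>

lemma Omega_oracle_count:
  assumes eps: "0 < \<epsilon>" "\<epsilon> \<le> sqrt (L * \<alpha>) * initial_dist / sqrt 2"
  defines "K \<equiv> oracle_count (is_done \<epsilon>) p r"
  shows "1 \<le> K" "Omega K * \<epsilon> \<le> 3 * (L * initial_dist)"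
proof -
  have "1 \<le> K \<and> is_done \<epsilon> (acgd_output p r K)"
    unfolding K_def oracle_count_def by (rule LeastI_ex) (use oracle_count_bound(1)[OF eps] in blast)
  then show K: "1 \<le> K" by blast
  have "sqrt (L * \<alpha>) * initial_dist / sqrt 2 \<le> L * initial_dist / 1"
    using sqrt_L_alpha_le initial_dist_pos L_pos by (intro frac_le mult_right_mono) auto
  then have eps': "\<epsilon> \<le> L * initial_dist" using eps by linarith
  show "Omega K * \<epsilon> \<le> 3 * (L * initial_dist)"
  proof (cases "K = 1")
    case True
    have "0 < L * initial_dist" using L_pos initial_dist_pos by simp
    then show ?thesis using True eps' by (simp add: Omega_def omega_1[simplified])
  next
    case False
    then have K1: "1 \<le> K - 1" "Suc (K - 1) = K" using K by auto
    have "\<not> is_done \<epsilon> (acgd_output p r (K - 1))"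
    proof
      assume "is_done \<epsilon> (acgd_output p r (K - 1))"
      then have "K \<le> K - 1" using K1(1) unfolding K_def oracle_count_def by (intro Least_le) auto
      then show False using K by simp
    qed
    then have "\<not> L * initial_dist \<le> Omega (K - 1) * \<epsilon>"
      using output_approx_optimal[OF K1(1)] by blast
    moreover have "Omega K * \<epsilon> \<le> 3 * Omega (K - 1) * \<epsilon>"
      using Omega_Suc_le[OF K1(1)] eps unfolding K1(2) by (intro mult_right_mono) auto
    ultimately show ?thesis by linarith
  qed
qed

text \<open>Combine \<open>W\<^sup>2 \<le> 2 \<Delta> \<Omega>\<close> with \<open>\<Omega> \<le> 3 L A / \<epsilon>\<close>. The factor \<open>L\<close> cancels against \<open>\<Delta> = R\<^sup>2 / (\<alpha> L)\<close>, and \<open>R\<^sup>2 A\<close> is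
  the sum of \<open>(R \<parallel>x\<^sup>0 - x\<^sup>*\<parallel>)\<^sup>2\<close> and twice the square of \<open>\<parallel>\<lambda>\<^sup>*\<parallel> + c\<close>.\<close>

lemma W_oracle_count:
  assumes eps: "0 < \<epsilon>" "\<epsilon> \<le> sqrt (L * \<alpha>) * initial_dist / sqrt 2"
  shows "st_W p (Suc (oracle_count (is_done \<epsilon>) p r))
    \<le> 4 * (R * norm (x0 - xs) + (norm ls + c)) / sqrt (\<alpha> * \<epsilon>)"
proof -
  define K where "K = oracle_count (is_done \<epsilon>) p r"
  define D where "D = norm (x0 - xs)"
  define d where "d = norm ls + c"
  have D: "0 \<le> D" by (simp add: D_def)
  have d: "0 \<le> d" using c norm_ge_zero[of ls] by (simp add: d_def)
  have "(st_W p (Suc K))\<^sup>2 \<le> 2 * \<Delta> * Omega K"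
    unfolding Omega_def using Omega_oracle_count(1)[OF eps] by (intro W_power2_le) (simp add: K_def)
  also have "\<dots> \<le> 2 * \<Delta> * (3 * (L * initial_dist) / \<epsilon>)"
    using Omega_oracle_count(2)[OF eps] eps Delta_pos
    by (intro mult_left_mono) (auto simp: K_def pos_le_divide_eq)
  also have "\<dots> = 6 * (R\<^sup>2 * initial_dist) / (\<alpha> * \<epsilon>)"
    using L_pos alpha eps by (simp add: \<Delta>_def)
  also have "R\<^sup>2 * initial_dist = (R * D)\<^sup>2 + 2 * d\<^sup>2"
    using R by (simp add: initial_dist_def D_def d_def field_simps)
  also have "6 * ((R * D)\<^sup>2 + 2 * d\<^sup>2) / (\<alpha> * \<epsilon>) \<le> (4 * (R * D + d))\<^sup>2 / (\<alpha> * \<epsilon>)"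
  proof (rule divide_right_mono)
    have "0 \<le> (R * D) * d" "0 \<le> (R * D)\<^sup>2" "0 \<le> d\<^sup>2" using R D d by auto
    then show "6 * ((R * D)\<^sup>2 + 2 * d\<^sup>2) \<le> (4 * (R * D + d))\<^sup>2"
      by (simp add: power2_sum power_mult_distrib[of 4] algebra_simps)
  qed (use alpha eps in simp)
  also have "\<dots> = (4 * (R * D + d) / sqrt (\<alpha> * \<epsilon>))\<^sup>2"
    using alpha eps by (simp add: power_divide)
  finally have "st_W p (Suc K) \<le> 4 * (R * D + d) / sqrt (\<alpha> * \<epsilon>)"
    by (rule power2_le_imp_le) (use R D d alpha eps in simp)
  then show ?thesis by (simp add: K_def D_def d_def)
qed

lemma jacobian_bound_nu_size:
  assumes "jacobian_bound g xs (xu ` {1..}) B" "1 \<le> t"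
  shows "nu_size r t \<le> B"
proof -
  have "max 1 (opnorm (jac g (xu t))) \<le> B" using assms by (auto simp: jacobian_bound_def)
  then show ?thesis by (auto simp: nu_size_def nu_eq)
qed

lemma matvec_count_bound:
  assumes eps: "0 < \<epsilon>" "\<epsilon> \<le> sqrt (L * \<alpha>) * initial_dist / sqrt 2"
    and mv: "\<And>t s. mv t s \<le> 3"
    and B: "jacobian_bound g xs (xu ` {1..}) B"
  shows "real (matvec_count mv (is_done \<epsilon>) p r)
    \<le> 6 * real (oracle_count (is_done \<epsilon>) p r)
      + 36 * (B / sqrt (\<alpha> * \<epsilon>) * (R * norm (x0 - xs) + (norm ls + c)))"
proof -
  define K where "K = oracle_count (is_done \<epsilon>) p r"
  have B0: "0 \<le> B" using jacobian_bound_nu_size[OF B, of 1] M_pos[of 1] by simp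
  have "real (matvec_count mv (is_done \<epsilon>) p r) \<le> (\<Sum>t = 1..K. 3 * real (st_S p t))"
  proof -
    have "(\<Sum>s = 1..st_S p t. mv t s) \<le> 3 * st_S p t" for t
      using sum_bounded_above[of "{1..st_S p t}" "mv t" 3] mv by (simp add: mult.commute)
    then have "matvec_count mv (is_done \<epsilon>) p r \<le> (\<Sum>t = 1..K. 3 * st_S p t)"
      unfolding matvec_count_def K_def by (intro sum_mono)
    then have "real (matvec_count mv (is_done \<epsilon>) p r) \<le> real (\<Sum>t = 1..K. 3 * st_S p t)"
      by (rule of_nat_mono)
    then show ?thesis by simp
  qed
  also have "\<dots> = 3 * (\<Sum>t = 1..K. real (st_S p t))" by (simp add: sum_distrib_left)
  also have "\<dots> \<le> 3 * (2 * real K + 3 * B * st_W p (Suc K))"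
    using sum_S_le[of B K] jacobian_bound_nu_size[OF B] Omega_oracle_count(1)[OF eps]
    by (intro mult_left_mono) (auto simp: K_def)
  also have "3 * B * st_W p (Suc K)
      \<le> 3 * B * (4 * (R * norm (x0 - xs) + (norm ls + c)) / sqrt (\<alpha> * \<epsilon>))"
    using W_oracle_count[OF eps] B0 unfolding K_def by (intro mult_left_mono) auto
  finally have "real (matvec_count mv (is_done \<epsilon>) p r) \<le> 3 * (2 * real K
      + 3 * B * (4 * (R * norm (x0 - xs) + (norm ls + c)) / sqrt (\<alpha> * \<epsilon>)))"
    by simp
  moreover have "3 * (2 * k + 3 * B * (4 * T / q)) = 6 * k + 36 * (B / q * T)" for k T q :: real
    by (simp add: distrib_left)
  ultimately show ?thesis by (simp only: K_def)
qed

end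

text \<open>The constants obtained are 16 for the phases, and 6 and 36 for the matrix-vector products. For
  \<open>R = d / \<parallel>x\<^sup>0 - x\<^sup>*\<parallel>\<close> both summands \<open>R \<parallel>x\<^sup>0 - x\<^sup>*\<parallel>\<close> and \<open>d\<close> agree, which doubles the 36, and
  \<open>A = 3 \<parallel>x\<^sup>0 - x\<^sup>*\<parallel>\<^sup>2\<close>.\<close>

theorem corollary4:
  fixes X :: "(real^'n) set"
    and f u :: "real^'n \<Rightarrow> real"
    and g :: "real^'n \<Rightarrow> real^'m"
    and \<alpha> c R \<epsilon> L \<kappa> d A :: real
    and xs x0 :: "real^'n"
    and ls :: "real^'m"
    and Lip :: "real^'m \<Rightarrow> real"
    and p :: steps
    and r :: "('n, 'm) iterates"
    and mv :: "nat \<Rightarrow> nat \<Rightarrow> nat"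
  assumes X: "closed X" "convex X"
    and f: "convex_on UNIV f" "\<And>x. f differentiable (at x)"
      "\<exists>C. C-lipschitz_on UNIV (grad f)"
    and g: "\<And>i. convex_on UNIV (\<lambda>x. g x $ i)" "\<And>x. g differentiable (at x)"
      "\<And>i. \<exists>C. C-lipschitz_on UNIV (grad (\<lambda>x. g x $ i))"
    and u: "convex_on X u" "strongly_convex_on X \<alpha> u"
    and params: "\<alpha> > 0" "c \<ge> 1" "R > 0"
    and kkt: "kkt_pair X f g u xs ls"
    and Lip: "\<And>l. l \<in> nonneg_orthant \<Longrightarrow> (Lip l)-lipschitz_on UNIV (grad (\<lambda>x. f x + l \<bullet> g x))"
      "bdd_above (Lip ` multiplier_set ls c)" "Lip 0 \<ge> \<alpha>"
    and L: "L = (SUP l\<in>multiplier_set ls c. Lip l)"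
    and \<kappa>: "\<kappa> = L / \<alpha>"
    and d: "d = norm ls + c"
    and A: "A = (norm (x0 - xs))\<^sup>2 + 2 * d\<^sup>2 / R\<^sup>2"
    and \<epsilon>: "0 < \<epsilon>" "\<epsilon> \<le> sqrt (L * \<alpha>) * A / sqrt 2"
    and run: "acgd_s_run X f g u x0 p r"
    and rule: "sc_rule \<alpha> L R r p"
    and nontrivial: "\<not> approx_optimal (\<lambda>x. f x + u x) (f xs + u xs) g \<epsilon> (\<epsilon> / c) x0"
    and mv: "\<And>t s. mv t s \<le> 3"
  shows
    "let done = approx_optimal (\<lambda>x. f x + u x) (f xs + u xs) g \<epsilon> (\<epsilon> / c);
         N\<^sub>\<epsilon> = real (oracle_count done p r);
         C\<^sub>\<epsilon> = real (matvec_count mv done p r)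
     in
       bounded (it_xu r ` {1..}) \<and>
       (\<exists>N\<ge>1. done (acgd_output p r N)) \<and>
       N\<^sub>\<epsilon> \<le> abs_const * (sqrt \<kappa> * ln (sqrt (L * \<alpha>) * A / \<epsilon>) + 1) \<and>
       (\<forall>M. jacobian_bound g xs (it_xu r ` {1..}) M \<longrightarrow>
          C\<^sub>\<epsilon> \<le> abs_const * (N\<^sub>\<epsilon> + M / sqrt (\<alpha> * \<epsilon>) * (R * norm (x0 - xs) + d))) \<and>
       (x0 \<noteq> xs \<and> R = d / norm (x0 - xs) \<longrightarrow>
          N\<^sub>\<epsilon> \<le> abs_const
                 * (sqrt \<kappa> * ln (3 * sqrt (L * \<alpha>) * (norm (x0 - xs))\<^sup>2 / \<epsilon>) + 1) \<and>
          (\<forall>M. jacobian_bound g xs (it_xu r ` {1..}) M \<longrightarrow>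
             C\<^sub>\<epsilon> \<le> abs_const * (M * d / sqrt (\<alpha> * \<epsilon>) + N\<^sub>\<epsilon>)))"
proof -
  interpret acgd_s X f u g \<alpha> c R L xs x0 ls Lip p r
    by unfold_locales (use assms in auto)
  define fin where "fin = approx_optimal (\<lambda>x. f x + u x) (f xs + u xs) g \<epsilon> (\<epsilon> / c)"
  define N where "N = real (oracle_count fin p r)"
  define C where "C = real (matvec_count mv fin p r)"
  define D where "D = norm (x0 - xs)"
  have A': "A = initial_dist" by (simp add: A initial_dist_def d)
  note eps = \<epsilon>[unfolded A']
  have d_pos: "0 < d" unfolding d using params norm_ge_zero[of ls] by linarith
  have bdd: "bounded (it_xu r ` {1..})"
    by (rule bounded_subset[OF bounded_xu]) auto
  have ex: "\<exists>N\<ge>1. fin (acgd_output p r N)"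
    unfolding fin_def by (rule oracle_count_bound(1)[OF eps])
  have kap: "0 \<le> sqrt \<kappa>" using L_pos params by (simp add: \<kappa>)
  have "\<sigma> = sqrt 2 * sqrt \<kappa>" unfolding \<sigma>_def \<kappa> by (rule real_sqrt_mult)
  moreover have "sqrt 2 * sqrt \<kappa> \<le> 2 * sqrt \<kappa>"
    using kap real_sqrt_le_mono[of 2 4] by (intro mult_right_mono) auto
  ultimately have sig: "\<sigma> \<le> 2 * sqrt \<kappa>" by simp
  have "sqrt 2 \<le> sqrt (L * \<alpha>) * A / \<epsilon>" using \<epsilon> by (simp add: field_simps)
  moreover have "1 < sqrt 2" by simp
  ultimately have "1 < sqrt (L * \<alpha>) * A / \<epsilon>" by linarith
  then have lnE: "0 < ln (sqrt (L * \<alpha>) * A / \<epsilon>)" by (rule ln_gt_zero)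
  have Nb: "N \<le> abs_const * (sqrt \<kappa> * ln (sqrt (L * \<alpha>) * A / \<epsilon>) + 1)"
  proof -
    have "N \<le> 8 * \<sigma> * ln (sqrt (L * \<alpha>) * A / \<epsilon>) + 1"
      using oracle_count_bound(2)[OF eps] unfolding N_def fin_def A' .
    also have "8 * \<sigma> * ln (sqrt (L * \<alpha>) * A / \<epsilon>) \<le> 8 * (2 * sqrt \<kappa>) * ln (sqrt (L * \<alpha>) * A / \<epsilon>)"
      using sig lnE by (intro mult_right_mono mult_left_mono) auto
    also have "8 * (2 * sqrt \<kappa>) * ln (sqrt (L * \<alpha>) * A / \<epsilon>) + 1
        \<le> 1000 * (sqrt \<kappa> * ln (sqrt (L * \<alpha>) * A / \<epsilon>)) + 1000"
      using mult_nonneg_nonneg[OF kap less_imp_le[OF lnE]] by linarith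
    finally show ?thesis by (simp add: abs_const_def)
  qed
  have N0: "0 \<le> N" by (simp add: N_def)
  have Cb: "C \<le> 6 * N + 36 * (B / sqrt (\<alpha> * \<epsilon>) * (R * D + d))"
    if "jacobian_bound g xs (it_xu r ` {1..}) B" for B
    using matvec_count_bound[OF eps mv that] unfolding C_def N_def fin_def D_def d .
  have B0: "0 \<le> B / sqrt (\<alpha> * \<epsilon>) * T"
    if "jacobian_bound g xs (it_xu r ` {1..}) B" "0 \<le> T" for B T
  proof -
    have "0 < B" using jacobian_bound_nu_size[OF that(1), of 1] M_pos[of 1] by simp
    then show ?thesis using that params \<epsilon> by simp
  qed
  have C1: "C \<le> abs_const * (N + B / sqrt (\<alpha> * \<epsilon>) * (R * D + d))"
    if B: "jacobian_bound g xs (it_xu r ` {1..}) B" for B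
  proof -
    define T where "T = B / sqrt (\<alpha> * \<epsilon>) * (R * D + d)"
    have "0 \<le> T"
      unfolding T_def using params d_pos by (intro B0[OF B]) (simp add: D_def)
    then have "C \<le> 1000 * N + 1000 * T"
      using Cb[OF B, folded T_def] N0 by linarith
    then show ?thesis unfolding T_def[symmetric] by (simp add: abs_const_def distrib_left)
  qed
  have special: "N \<le> abs_const * (sqrt \<kappa> * ln (3 * sqrt (L * \<alpha>) * D\<^sup>2 / \<epsilon>) + 1) \<and>
      (\<forall>M. jacobian_bound g xs (it_xu r ` {1..}) M \<longrightarrow>
         C \<le> abs_const * (M * d / sqrt (\<alpha> * \<epsilon>) + N))"
    if R': "x0 \<noteq> xs" "R = d / D"
  proof -
    have D: "0 < D" using R' by (simp add: D_def)
    have RD: "R * D = d" using D R' by simp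
    have "d\<^sup>2 / R\<^sup>2 = D\<^sup>2" unfolding RD[symmetric] using params by (simp add: power_mult_distrib)
    then have "A = 3 * D\<^sup>2" unfolding A D_def[symmetric] by simp
    then have 1: "N \<le> abs_const * (sqrt \<kappa> * ln (3 * sqrt (L * \<alpha>) * D\<^sup>2 / \<epsilon>) + 1)"
      using Nb by (simp add: mult_ac)
    have 2: "C \<le> abs_const * (B * d / sqrt (\<alpha> * \<epsilon>) + N)"
      if B: "jacobian_bound g xs (it_xu r ` {1..}) B" for B
    proof -
      have "B / sqrt (\<alpha> * \<epsilon>) * (R * D + d) = 2 * (B * d / sqrt (\<alpha> * \<epsilon>))" by (simp add: RD)
      moreover have "0 \<le> B * d / sqrt (\<alpha> * \<epsilon>)" using B0[OF B, of d] d_pos by simp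
      ultimately have "C \<le> 1000 * (B * d / sqrt (\<alpha> * \<epsilon>)) + 1000 * N"
        using Cb[OF B] N0 by linarith
      then show ?thesis by (simp add: abs_const_def distrib_left)
    qed
    show ?thesis using 1 2 by blast
  qed
  show ?thesis
    unfolding Let_def fin_def[symmetric] N_def[symmetric] C_def[symmetric] D_def[symmetric]
    using bdd ex Nb C1 special by blast
qed

end
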